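(* Let $T$ and $T'$ be two $(\leq 4)$-hypomorphic tournaments on the same set $V$ of $v$ vertices. Let $p$ be a prime number and $k=\sum_{i=0}^{k(p)} k_ip^i$ (base-$p$ expansion) an integer with $6\leq k\leq v-6$. 1) If $b^+_6(T_{\restriction K})=b^+_6(T'_{\restriction K})$ for all $k$-element subsets $K$ of $V$, then $T'$ and $T$ are hereditarily isomorphic. 2) Assume $b^+_6(T_{\restriction K})\equiv b^+_6(T'_{\restriction K}) \pmod p$ for all $k$-element subsets $K$ of $V$. a) If $p\geq 7$, and $k_0\geq 6$ or $k_0=0$, then $T'$ and $T$ are hereditarily isomorphic. b) If ($p=5$, $k_0=1$ and $k_1\neq 0$) or ($p=3$, $k_0=0$ and $k_1=2$) or ($p=3$ and $k_0=k_1=0$) or ($p=2$, $k_0=0$ and $k_1=k_2=1$), then $T'$ and $T$ are hereditarily isomorphic.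
   Context: Tournaments: for distinct vertices $x,y$ exactly one of the arcs $(x,y),(y,x)$ is present; $x\to y$ means $(x,y)$ is an arc. $T_{\restriction K}$ is the induced subtournament on $K$. $\beta^+_6$ is the tournament on $\{0,1,2,3,4,5\}$ with arcs $0\to1$, $0\to2$, $1\to2$, $3\to4$, every vertex of $\{0,1,2\}$ dominating every vertex of $\{3,4\}$, every vertex of $\{3,4\}$ dominating $5$, and $5$ dominating every vertex of $\{0,1,2\}$. $b^+_6(T)$ is the number of $6$-element vertex subsets $S$ with $T_{\restriction S}\simeq\beta^+_6$. Tournaments $T,T'$ on the same set $V$ are $h$-hypomorphic if $T_{\restriction K}\simeq T'_{\restriction K}$ for every $h$-element $K\subseteq V$, and $(\leq k)$-hypomorphic if $h$-hypomorphic for all $h\le k$. They are hereditarily isomorphic if $T_{\restriction X}\simeq T'_{\restriction X}$ for every $X\subseteq V$. For an integer $n$, $n=\sum_i n_ip^i$ with digits $n_i\in\{0,\dots,p-1\}$ is its base-$p$ expansion. *)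

theory Defs
  imports "Graph_Theory.Graph_Theory" "HOL-Number_Theory.Cong"
begin

text \<open>
  The locale \<^locale>\<open>digraph\<close> already requires finiteness and excludes loops and parallel arcs.
\<close>

locale tournament = digraph G for G :: "('a, 'b) pre_digraph" +
  assumes exactly_one_arc:
    "\<lbrakk>x \<in> verts G; y \<in> verts G; x \<noteq> y\<rbrakk> \<Longrightarrow>
      (x, y) \<in> arcs_ends G \<and> (y, x) \<notin> arcs_ends G \<or>
      (y, x) \<in> arcs_ends G \<and> (x, y) \<notin> arcs_ends G"

definition beta6_plus :: "(nat, nat \<times> nat) pre_digraph" where
  "beta6_plus = with_proj \<lparr> pverts = {0, 1, 2, 3, 4, 5},
     parcs = {(0, 1), (0, 2), (1, 2), (3, 4)}
       \<union> {0, 1, 2} \<times> {3, 4} \<union> {3, 4} \<times> {5} \<union> {5} \<times> {0, 1, 2} \<rparr>"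

lemma tournament_beta6_plus: "tournament beta6_plus"
proof -
  have v: "verts beta6_plus = {0, 1, 2, 3, 4, 5}"
    and a: "arcs beta6_plus = {(0, 1), (0, 2), (1, 2), (3, 4)}
       \<union> {0, 1, 2} \<times> {3, 4} \<union> {3, 4} \<times> {5} \<union> {5} \<times> {0, 1, 2}"
    and t: "tail beta6_plus = fst" and h: "head beta6_plus = snd"
    and e: "arcs_ends beta6_plus = arcs beta6_plus"
    by (simp_all add: beta6_plus_def)
  show ?thesis
  proof unfold_locales
    fix x y
    assume "x \<in> verts beta6_plus" "y \<in> verts beta6_plus" "x \<noteq> y"
    then show "(x, y) \<in> arcs_ends beta6_plus \<and> (y, x) \<notin> arcs_ends beta6_plus \<or>
        (y, x) \<in> arcs_ends beta6_plus \<and> (x, y) \<notin> arcs_ends beta6_plus"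
      unfolding e a v insert_iff by (elim disjE) simp_all
  next
    fix c
    assume "c \<in> arcs beta6_plus"
    then show "tail beta6_plus c \<in> verts beta6_plus"
      and "head beta6_plus c \<in> verts beta6_plus"
      and "tail beta6_plus c \<noteq> head beta6_plus c"
      unfolding a t h v by - (elim UnE SigmaE insertE emptyE; simp)+
  next
    show "finite (verts beta6_plus)" and "finite (arcs beta6_plus)"
      by (simp_all add: a v)
  next
    fix c c'
    assume "arc_to_ends beta6_plus c = arc_to_ends beta6_plus c'"
    then show "c = c'" by (simp add: arc_to_ends_def t h prod_eq_iff)
  qed
qed

definition b6_plus :: "('a, 'b) pre_digraph \<Rightarrow> nat" where
  "b6_plus G = card {S. S \<subseteq> verts G \<and> card S = 6 \<and> digraph_iso (G \<restriction> S) beta6_plus}"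

definition hypomorphic :: "nat \<Rightarrow> ('a, 'b) pre_digraph \<Rightarrow> ('a, 'c) pre_digraph \<Rightarrow> bool" where
  "hypomorphic h G H \<longleftrightarrow> verts G = verts H \<and>
     (\<forall>K. K \<subseteq> verts G \<and> finite K \<and> card K = h \<longrightarrow> digraph_iso (G \<restriction> K) (H \<restriction> K))"

definition le_hypomorphic :: "nat \<Rightarrow> ('a, 'b) pre_digraph \<Rightarrow> ('a, 'c) pre_digraph \<Rightarrow> bool" where
  "le_hypomorphic k G H \<longleftrightarrow> (\<forall>h\<le>k. hypomorphic h G H)"

definition hereditarily_isomorphic :: "('a, 'b) pre_digraph \<Rightarrow> ('a, 'c) pre_digraph \<Rightarrow> bool" where
  "hereditarily_isomorphic G H \<longleftrightarrow> verts G = verts H \<and>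
     (\<forall>X. X \<subseteq> verts G \<longrightarrow> digraph_iso (G \<restriction> X) (H \<restriction> X))"

text \<open>
  The digits are indexed by all natural numbers, those beyond the highest index \<open>m\<close> being zero,
  so that for instance \<open>d 1\<close> and \<open>d 2\<close> are meaningful for every \<open>k\<close>.
\<close>

definition base_expansion :: "nat \<Rightarrow> nat \<Rightarrow> nat \<Rightarrow> (nat \<Rightarrow> nat) \<Rightarrow> bool" where
  "base_expansion p k m d \<longleftrightarrow>
     (\<forall>i. d i < p) \<and> (\<forall>i>m. d i = 0) \<and> k = (\<Sum>i\<le>m. d i * p ^ i)"

end

theory Submission
  imports Defs "HOL-Library.Sublist"
begin

text \<open>
  The difference of the indicators of the 6-sets inducing \<open>\<beta>\<^sup>+\<^sub>6\<close> in \<open>T\<close> and in \<open>T'\<close> has vanishing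
  sums, modulo \<open>p\<close> or exactly, over all \<open>k\<close>-sets. Under the digit conditions such a function is
  constant, and hence zero, since not all 6-sets of a tournament on 12 vertices induce \<open>\<beta>\<^sup>+\<^sub>6\<close>.

  Join two vertices if \<open>T\<close> and \<open>T'\<close> disagree on their arc. A connected component \<open>C\<close> of this graph
  is an interval on which both tournaments contain no diamond (a 3-cycle with a common
  in- or out-neighbour) and every 3-cycle of \<open>T\<close> is reversed in \<open>T'\<close>, so that \<open>T'\<close> restricted to
  a subset of \<open>C\<close> is isomorphic to the dual of \<open>T\<close>. As \<open>\<beta>\<^sup>+\<^sub>6\<close> is not self-dual, \<open>T\<close> contains neither
  \<open>\<beta>\<^sup>+\<^sub>6\<close> nor its dual inside \<open>C\<close>. A diamond-free tournament is a linear order switched along a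
  vertex set, that is, a binary word up to negated rotation; the words avoiding \<open>\<beta>\<^sup>+\<^sub>6\<close> and its
  dual are few and equivalent to their reversals. Hence \<open>T\<close> and \<open>T'\<close> are isomorphic on each
  component, and these isomorphisms glue.
\<close>

section \<open>Kernels of inclusion matrices\<close>

text \<open>By the absorption identity, \<open>p ^ e\<close> divides \<open>i\<close> times the
  binomial; a binomial coprime to \<open>p\<close> would force \<open>p ^ e\<close> to divide the
  smaller \<open>i\<close>.\<close>

lemma prime_dvd_prime_power_choose:
  fixes p :: nat
  assumes "prime p" "0 < i" "i < p ^ e"
  shows "p dvd (p ^ e choose i)"
proof (rule ccontr)
  assume "\<not> p dvd (p ^ e choose i)"
  then have "coprime p (p ^ e choose i)"
    using prime_imp_coprime[OF assms(1)] by blast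
  then have "coprime (p ^ e) (p ^ e choose i)"
    by simp
  moreover have "p ^ e dvd i * (p ^ e choose i)"
    using assms(2) by (subst times_binomial_minus1_eq) simp_all
  ultimately have "p ^ e dvd i"
    using coprime_dvd_mult_left_iff by blast
  then have "p ^ e \<le> i"
    using assms(2) by (rule dvd_imp_le)
  then show False
    using assms(3) by linarith
qed

text \<open>In the Vandermonde convolution \<open>p\<close> divides every term with
  \<open>0 < i\<close>, so only \<open>i = 0\<close> survives. This is the fragment of Lucas'
  theorem behind the digit conditions.\<close>

lemma choose_add_prime_power_cong:
  fixes p :: nat
  assumes "prime p" "j < p ^ e"
  shows "[(n + p ^ e) choose j = n choose j] (mod p)"
proof -
  have "(n + p ^ e) choose j = (\<Sum>i\<le>j. (p ^ e choose i) * (n choose (j - i)))"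
    by (simp add: vandermonde add.commute)
  also have "\<dots> = (n choose j) + (\<Sum>i\<in>{0<..j}. (p ^ e choose i) * (n choose (j - i)))"
  proof -
    have "{..j} = insert 0 {0<..j}" by auto
    then show ?thesis by simp
  qed
  finally have *: "(n + p ^ e) choose j
      = (n choose j) + (\<Sum>i\<in>{0<..j}. (p ^ e choose i) * (n choose (j - i)))" .
  have "p dvd (\<Sum>i\<in>{0<..j}. (p ^ e choose i) * (n choose (j - i)))"
    using assms by (intro dvd_sum dvd_mult2 prime_dvd_prime_power_choose) auto
  then show ?thesis
    unfolding * by (simp only: cong_add_lcancel_0_nat cong_0_iff)
qed

lemma choose_add_mult_prime_power_cong:
  fixes p :: nat
  assumes "prime p" "j < p ^ e"
  shows "[(n + r * p ^ e) choose j = n choose j] (mod p)"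
proof (induction r)
  case (Suc r)
  have "[(n + r * p ^ e + p ^ e) choose j = (n + r * p ^ e) choose j] (mod p)"
    by (rule choose_add_prime_power_cong[OF assms])
  then show ?case
    using Suc by (auto intro: cong_trans simp: algebra_simps)
qed simp

lemma prime_not_dvd_choose:
  fixes p :: nat
  assumes "prime p" "n < p" "j \<le> n"
  shows "\<not> p dvd (n choose j)"
proof
  assume "p dvd (n choose j)"
  then have "p dvd fact n"
    using assms(3) by (metis binomial_fact_lemma dvd_mult)
  then show False
    using assms by (simp add: prime_dvd_fact_iff)
qed

lemma sum_subsets_insert:
  fixes f :: "'a set \<Rightarrow> int"
  assumes "finite K" "x \<notin> K"
  shows "(\<Sum>S | S \<subseteq> insert x K \<and> card S = Suc t. f S)
    = (\<Sum>S | S \<subseteq> K \<and> card S = Suc t. f S) + (\<Sum>S | S \<subseteq> K \<and> card S = t. f (insert x S))"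
proof -
  let ?A = "{S. S \<subseteq> K \<and> card S = Suc t}" and ?B = "{S. S \<subseteq> K \<and> card S = t}"
  have "{S. S \<subseteq> insert x K \<and> card S = Suc t} = ?A \<union> insert x ` ?B"
  proof (intro set_eqI iffI)
    fix S assume S: "S \<in> {S. S \<subseteq> insert x K \<and> card S = Suc t}"
    show "S \<in> ?A \<union> insert x ` ?B"
    proof (cases "x \<in> S")
      case True
      then have "S = insert x (S - {x})" "S - {x} \<in> ?B"
        using S by auto
      then show ?thesis by blast
    qed (use S in auto)
  next
    fix S assume "S \<in> ?A \<union> insert x ` ?B"
    then show "S \<in> {S. S \<subseteq> insert x K \<and> card S = Suc t}"
    proof
      assume "S \<in> insert x ` ?B"
      then obtain S0 where "S0 \<subseteq> K" "card S0 = t" "S = insert x S0" by auto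
      moreover have "finite S0" "x \<notin> S0"
        using calculation assms finite_subset by auto
      ultimately show ?thesis by auto
    qed auto
  qed
  moreover have "inj_on (insert x) ?B"
  proof (rule inj_onI)
    fix A B assume "A \<in> ?B" "B \<in> ?B" and eq: "insert x A = insert x B"
    then have "x \<notin> A" "x \<notin> B" using assms(2) by auto
    then show "A = B" using eq by (simp add: insert_ident)
  qed
  moreover have "?A \<inter> insert x ` ?B = {}"
    using assms(2) by auto
  ultimately show ?thesis
    using assms(1) by (simp add: sum.union_disjoint sum.reindex)
qed

text \<open>Elements of \<open>S\<close> are swapped one at a time for elements of
  \<open>S'\<close>; each swap shrinks \<open>S - S'\<close>.\<close>

lemma exchange_invariant_imp_constant:
  fixes f :: "'a set \<Rightarrow> int"
  assumes "finite V"
    and ex: "\<And>x y S. x \<in> V \<Longrightarrow> y \<in> V \<Longrightarrow> x \<noteq> y \<Longrightarrow> S \<subseteq> V - {x, y} \<Longrightarrow> card S = t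
      \<Longrightarrow> m dvd f (insert x S) - f (insert y S)"
    and "S \<subseteq> V" "card S = Suc t" "S' \<subseteq> V" "card S' = Suc t"
  shows "m dvd f S - f S'"
  using assms(3,4)
proof (induction "card (S - S')" arbitrary: S rule: less_induct)
  case less
  have fin: "finite S" "finite S'"
    using less.prems assms(1,5) finite_subset by auto
  show ?case
  proof (cases "S = S'")
    case False
    then obtain x y where x: "x \<in> S" "x \<notin> S'" and y: "y \<in> S'" "y \<notin> S"
      using fin less.prems assms(6) by (metis card_subset_eq subsetI)
    let ?S = "insert y (S - {x})"
    have "m dvd f (insert x (S - {x})) - f ?S"
      using x y less.prems assms(5) fin by (intro ex) auto
    moreover have "insert x (S - {x}) = S" using x by auto
    moreover have "?S - S' \<subset> S - S'"
      using x y by auto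
    then have "m dvd f ?S - f S'"
      using x y less.prems assms(5) fin by (intro less.hyps) (auto intro: psubset_card_mono)
    ultimately show ?thesis
      using dvd_add[of m "f S - f ?S" "f ?S - f S'"] by simp
  qed simp
qed

text \<open>
  A differencing argument: for distinct \<open>x\<close> and \<open>y\<close> the function
  \<open>S \<mapsto> f (insert x S) - f (insert y S)\<close> on \<open>(t - 1)\<close>-subsets of \<open>V - {x, y}\<close> has vanishing
  sums over \<open>(k - 1)\<close>-subsets, because the sets avoiding both \<open>x\<close> and \<open>y\<close> cancel. The modulus
  \<open>m = 0\<close> covers equality of integers.
\<close>
lemma inclusion_kernel:
  fixes f :: "'a set \<Rightarrow> int"
  assumes "finite V" "t \<le> k" "t + k \<le> card V"
    and "\<And>K. K \<subseteq> V \<Longrightarrow> card K = k \<Longrightarrow> m dvd (\<Sum>S | S \<subseteq> K \<and> card S = t. f S)"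
    and "\<And>i a. 1 \<le> i \<Longrightarrow> i \<le> t \<Longrightarrow> m dvd a * int (k - i choose (t - i)) \<Longrightarrow> m dvd a"
  shows inclusion_kernel_constant:
      "\<And>S S'. S \<subseteq> V \<Longrightarrow> card S = t \<Longrightarrow> S' \<subseteq> V \<Longrightarrow> card S' = t \<Longrightarrow> m dvd f S - f S'"
    and inclusion_kernel_trivial:
      "\<And>S. (\<And>a. m dvd a * int (k choose t) \<Longrightarrow> m dvd a) \<Longrightarrow> S \<subseteq> V \<Longrightarrow> card S = t \<Longrightarrow> m dvd f S"
proof -
  have "(\<forall>S S'. S \<subseteq> V \<longrightarrow> card S = t \<longrightarrow> S' \<subseteq> V \<longrightarrow> card S' = t \<longrightarrow> m dvd f S - f S') \<and>
    ((\<forall>a. m dvd a * int (k choose t) \<longrightarrow> m dvd a) \<longrightarrow> (\<forall>S. S \<subseteq> V \<longrightarrow> card S = t \<longrightarrow> m dvd f S))"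
    using assms
  proof (induction t arbitrary: V k f)
    case 0
    have fin: "finite S" if "S \<subseteq> V" for S
      using that 0 finite_subset by auto
    obtain K where K: "K \<subseteq> V" "card K = k"
      using 0 obtain_subset_with_card_n[of k V] by auto
    have "{S. S \<subseteq> K \<and> card S = 0} = {{}}"
      using K fin[of K] by (auto dest: finite_subset)
    then have "m dvd f {}"
      using 0(4)[OF K] by simp
    then show ?case using fin by auto
  next
    case (Suc t)
    have ex: "m dvd f (insert x S) - f (insert y S)"
      if xy: "x \<in> V" "y \<in> V" "x \<noteq> y" and S: "S \<subseteq> V - {x, y}" "card S = t" for x y S
    proof -
      let ?g = "\<lambda>S. f (insert x S) - f (insert y S)"
      have sums: "m dvd (\<Sum>S | S \<subseteq> K \<and> card S = t. ?g S)"
        if K: "K \<subseteq> V - {x, y}" "card K = k - 1" for K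
      proof -
        have fK: "finite K" using K Suc.prems(1) finite_subset by blast
        have xK: "x \<notin> K" "y \<notin> K" using K by auto
        have "m dvd (\<Sum>S | S \<subseteq> insert x K \<and> card S = Suc t. f S)"
          using K xy xK fK Suc.prems(2) by (intro Suc.prems(4)) auto
        moreover have "m dvd (\<Sum>S | S \<subseteq> insert y K \<and> card S = Suc t. f S)"
          using K xy xK fK Suc.prems(2) by (intro Suc.prems(4)) auto
        ultimately show ?thesis
          using dvd_diff[of m "\<Sum>S | S \<subseteq> insert x K \<and> card S = Suc t. f S"
              "\<Sum>S | S \<subseteq> insert y K \<and> card S = Suc t. f S"]
          by (simp add: sum_subsets_insert fK xK sum_subtractf)
      qed
      \<comment> \<open>Index \<open>i\<close> of the differenced problem is index
        \<open>Suc i\<close> of the original one, so that \<open>i = 0\<close> is available as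
        well.\<close>
      have cancel: "m dvd a" if "i \<le> t" "m dvd a * int (k - 1 - i choose (t - i))" for i a
        using that Suc.prems(5)[of "Suc i" a] by simp
      have "card (V - {x, y}) = card V - 2"
        using xy Suc.prems(1) by (simp add: card_Diff_subset)
      then have "t + (k - 1) \<le> card (V - {x, y})" "t \<le> k - 1"
        using Suc.prems(2,3) by auto
      moreover have "finite (V - {x, y})" using Suc.prems(1) by simp
      ultimately have "(\<forall>S S'. S \<subseteq> V - {x, y} \<longrightarrow> card S = t \<longrightarrow> S' \<subseteq> V - {x, y} \<longrightarrow>
          card S' = t \<longrightarrow> m dvd ?g S - ?g S') \<and>
        ((\<forall>a. m dvd a * int (k - 1 choose t) \<longrightarrow> m dvd a) \<longrightarrow>
          (\<forall>S. S \<subseteq> V - {x, y} \<longrightarrow> card S = t \<longrightarrow> m dvd ?g S))"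
        using sums cancel by - (rule Suc.IH)
      \<comment> \<open>The cancellation at \<open>i = 0\<close> strengthens the induction
        hypothesis from constancy of \<open>?g\<close> to its vanishing.\<close>
      moreover have "\<forall>a. m dvd a * int (k - 1 choose t) \<longrightarrow> m dvd a"
        by (intro allI impI) (rule cancel[of 0], simp_all)
      ultimately have "\<forall>S. S \<subseteq> V - {x, y} \<longrightarrow> card S = t \<longrightarrow> m dvd ?g S"
        by (rule mp[OF conjunct2])
      then show ?thesis using S by simp
    qed
    have const: "m dvd f S - f S'"
      if "S \<subseteq> V" "card S = Suc t" "S' \<subseteq> V" "card S' = Suc t" for S S'
      by (rule exchange_invariant_imp_constant[where t = t, OF Suc.prems(1) _ that]) (rule ex)
    have "m dvd f S"
      if cancel: "\<forall>a. m dvd a * int (k choose Suc t) \<longrightarrow> m dvd a" and S: "S \<subseteq> V" "card S = Suc t" for S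
    proof -
      obtain K where K: "K \<subseteq> V" "card K = k"
        by (rule obtain_subset_with_card_n[of k V]) (use Suc.prems(3) in linarith)+
      have fK: "finite K" using K Suc.prems(1) finite_subset by blast
      let ?A = "{S. S \<subseteq> K \<and> card S = Suc t}"
      \<comment> \<open>By constancy the vanishing sum over the subsets of one \<open>k\<close>-set
        is, modulo \<open>m\<close>, \<open>f S\<close> times their number, which can be
        cancelled.\<close>
      have "m dvd (\<Sum>S'\<in>?A. f S - f S')"
        using K S by (intro dvd_sum const) auto
      moreover have "m dvd (\<Sum>S'\<in>?A. f S')"
        by (rule Suc.prems(4)[OF K])
      moreover have "(\<Sum>S'\<in>?A. f S - f S') + (\<Sum>S'\<in>?A. f S') = f S * int (k choose Suc t)"
        using n_subsets[OF fK, of "Suc t"] K by (simp add: sum_subtractf)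
      ultimately have "m dvd f S * int (k choose Suc t)"
        using dvd_add[of m "\<Sum>S'\<in>?A. f S - f S'" "\<Sum>S'\<in>?A. f S'"] by (simp only:)
      then show ?thesis by (rule cancel[rule_format])
    qed
    then show ?case by (intro conjI allI impI const)
  qed
  note * = this
  show "m dvd f S - f S'" if "S \<subseteq> V" "card S = t" "S' \<subseteq> V" "card S' = t" for S S'
    using *[THEN conjunct1, rule_format] that by this
  show "m dvd f S" if "\<And>a. m dvd a * int (k choose t) \<Longrightarrow> m dvd a" "S \<subseteq> V" "card S = t" for S
    by (rule *[THEN conjunct2, rule_format]) (fact that)+
qed

section \<open>Pairs of tournaments with the same 3-cycles and diamonds\<close>

definition tournament_on :: "'a set \<Rightarrow> ('a \<Rightarrow> 'a \<Rightarrow> bool) \<Rightarrow> bool" where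
  "tournament_on V E \<longleftrightarrow> (\<forall>x\<in>V. \<forall>y\<in>V. E x y \<longleftrightarrow> x \<noteq> y \<and> \<not> E y x)"

definition rel_iso :: "'a set \<Rightarrow> ('a \<Rightarrow> 'a \<Rightarrow> bool) \<Rightarrow> 'b set \<Rightarrow> ('b \<Rightarrow> 'b \<Rightarrow> bool) \<Rightarrow> bool" where
  "rel_iso V E W F \<longleftrightarrow> (\<exists>f. bij_betw f V W \<and> (\<forall>x\<in>V. \<forall>y\<in>V. E x y \<longleftrightarrow> F (f x) (f y)))"

definition cycle3 :: "('a \<Rightarrow> 'a \<Rightarrow> bool) \<Rightarrow> 'a \<Rightarrow> 'a \<Rightarrow> 'a \<Rightarrow> bool" where
  "cycle3 E a b c \<longleftrightarrow> E a b \<and> E b c \<and> E c a"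

lemma cycle3_conversep: "cycle3 E\<inverse>\<inverse> a b c \<longleftrightarrow> cycle3 E c b a"
  unfolding cycle3_def by auto

lemma tournament_on_subset: "tournament_on V E \<Longrightarrow> W \<subseteq> V \<Longrightarrow> tournament_on W E"
  unfolding tournament_on_def by blast

lemma tournament_on_conversep: "tournament_on V E \<Longrightarrow> tournament_on V E\<inverse>\<inverse>"
  unfolding tournament_on_def conversep_iff by metis

lemma tournament_onD:
  assumes "tournament_on V E" "x \<in> V" "y \<in> V"
  shows "E x y \<longleftrightarrow> x \<noteq> y \<and> \<not> E y x"
  using assms unfolding tournament_on_def by blast

lemma rel_iso_refl: "rel_iso V E V E"
  unfolding rel_iso_def by (intro exI[of _ id]) auto

lemma rel_iso_sym:
  assumes "rel_iso V E W F"
  shows "rel_iso W F V E"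
proof -
  obtain f where f: "bij_betw f V W" "\<forall>x\<in>V. \<forall>y\<in>V. E x y \<longleftrightarrow> F (f x) (f y)"
    using assms unfolding rel_iso_def by blast
  have "F x y \<longleftrightarrow> E (inv_into V f x) (inv_into V f y)" if "x \<in> W" "y \<in> W" for x y
    using f(2) that bij_betwE[OF bij_betw_inv_into[OF f(1)]]
    by (simp add: bij_betw_inv_into_right[OF f(1)])
  then show ?thesis
    unfolding rel_iso_def using bij_betw_inv_into[OF f(1)] by blast
qed

lemma rel_iso_trans:
  assumes "rel_iso U D V E" "rel_iso V E W F"
  shows "rel_iso U D W F"
proof -
  obtain f g where f: "bij_betw f U V" "\<forall>x\<in>U. \<forall>y\<in>U. D x y \<longleftrightarrow> E (f x) (f y)"
    and g: "bij_betw g V W" "\<forall>x\<in>V. \<forall>y\<in>V. E x y \<longleftrightarrow> F (g x) (g y)"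
    using assms unfolding rel_iso_def by blast
  then show ?thesis
    unfolding rel_iso_def
    by (intro exI[of _ "g \<circ> f"]) (auto intro: bij_betw_trans dest: bij_betwE)
qed

lemma rel_iso_conversep: "rel_iso V E W F \<Longrightarrow> rel_iso V E\<inverse>\<inverse> W F\<inverse>\<inverse>"
  unfolding rel_iso_def by auto

lemma rel_iso_cong:
  "(\<And>x y. x \<in> V \<Longrightarrow> y \<in> V \<Longrightarrow> E x y \<longleftrightarrow> F x y) \<Longrightarrow> rel_iso V E V F"
  unfolding rel_iso_def by (intro exI[of _ id]) auto

lemma rel_iso_card: "rel_iso V E W F \<Longrightarrow> card V = card W"
  unfolding rel_iso_def using bij_betw_same_card by blast

text \<open>Without 3-cycles a tournament is transitive, and the number of in-neighbours is the
  position in its linear order.\<close>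

lemma acyclic_tournament_imp_linear:
  assumes "finite V" "tournament_on V E"
    and "\<And>a b c. a \<in> V \<Longrightarrow> b \<in> V \<Longrightarrow> c \<in> V \<Longrightarrow> \<not> cycle3 E a b c"
  shows "rel_iso V E {..<card V} (<)"
proof -
  note E = tournament_onD[OF assms(2)]
  have trans: "E x z" if "x \<in> V" "y \<in> V" "z \<in> V" "E x y" "E y z" for x y z
    using assms(3)[of x y z] E[of x z] E[of x y] that unfolding cycle3_def by auto
  define f where "f x = card {y \<in> V. E y x}" for x
  have mono: "f x < f y" if "x \<in> V" "y \<in> V" "E x y" for x y
  proof -
    have "{z \<in> V. E z x} \<subset> {z \<in> V. E z y}"
      using that trans E[of x x] by blast
    then show ?thesis
      unfolding f_def using assms(1) by (intro psubset_card_mono) auto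
  qed
  have iff: "E x y \<longleftrightarrow> f x < f y" if "x \<in> V" "y \<in> V" for x y
    using mono[OF that] mono[of y x] E[OF that] that by fastforce
  have "inj_on f V"
    using iff E by (metis (no_types, lifting) inj_onI less_irrefl)
  moreover have "f x < card V" if "x \<in> V" for x
  proof -
    have "{y \<in> V. E y x} \<subset> V" using that E[of x x] by blast
    then show ?thesis unfolding f_def using assms(1) by (rule psubset_card_mono[rotated])
  qed
  ultimately have "bij_betw f V {..<card V}"
    by (intro bij_betw_imageI card_subset_eq) (auto simp: card_image)
  then show ?thesis
    unfolding rel_iso_def using iff by blast
qed

text \<open>What the argument takes from hypomorphy up to 4: 3-cycles survive up to orientation, and
  the apex of a diamond keeps its direction. The last two axioms name only the arc at
  \<open>a\<close>; rotating the 3-cycle gives the other two.\<close>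

locale tournament_pair =
  fixes V :: "'a set" and E F :: "'a \<Rightarrow> 'a \<Rightarrow> bool"
  assumes finite_V: "finite V"
    and tournament_E: "tournament_on V E"
    and tournament_F: "tournament_on V F"
    and cycle_EF: "\<And>a b c. \<lbrakk>a \<in> V; b \<in> V; c \<in> V; cycle3 E a b c\<rbrakk> \<Longrightarrow> cycle3 F a b c \<or> cycle3 F c b a"
    and cycle_FE: "\<And>a b c. \<lbrakk>a \<in> V; b \<in> V; c \<in> V; cycle3 F a b c\<rbrakk> \<Longrightarrow> cycle3 E a b c \<or> cycle3 E c b a"
    and source_EF: "\<And>a b c d. \<lbrakk>a \<in> V; b \<in> V; c \<in> V; d \<in> V; cycle3 E a b c; E d a; E d b; E d c\<rbrakk>
      \<Longrightarrow> F d a"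
    and sink_EF: "\<And>a b c d. \<lbrakk>a \<in> V; b \<in> V; c \<in> V; d \<in> V; cycle3 E a b c; E a d; E b d; E c d\<rbrakk>
      \<Longrightarrow> F a d"
begin

lemmas E_iff = tournament_onD[OF tournament_E] and F_iff = tournament_onD[OF tournament_F]

lemma E_irrefl: "x \<in> V \<Longrightarrow> \<not> E x x" and F_irrefl: "x \<in> V \<Longrightarrow> \<not> F x x"
  using E_iff[of x x] F_iff[of x x] by blast+

lemma E_asym: "x \<in> V \<Longrightarrow> y \<in> V \<Longrightarrow> E x y \<Longrightarrow> \<not> E y x"
  and F_asym: "x \<in> V \<Longrightarrow> y \<in> V \<Longrightarrow> F x y \<Longrightarrow> \<not> F y x"
  using E_iff[of x y] F_iff[of x y] by blast+

lemma E_opp: "x \<in> V \<Longrightarrow> y \<in> V \<Longrightarrow> x \<noteq> y \<Longrightarrow> E x y \<longleftrightarrow> \<not> E y x"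
  and F_opp: "x \<in> V \<Longrightarrow> y \<in> V \<Longrightarrow> x \<noteq> y \<Longrightarrow> F x y \<longleftrightarrow> \<not> F y x"
  using E_iff[of x y] F_iff[of x y] by blast+

section \<open>Components of the graph of reversed arcs\<close>

definition reversed :: "'a \<Rightarrow> 'a \<Rightarrow> bool" where
  "reversed x y \<longleftrightarrow> x \<in> V \<and> y \<in> V \<and> (E x y \<and> F y x \<or> E y x \<and> F x y)"

lemma reversed_flip: "reversed x y \<Longrightarrow> E x y \<longleftrightarrow> \<not> F x y"
  unfolding reversed_def using E_asym F_asym by metis

lemma reversed_in: "reversed x y \<Longrightarrow> x \<in> V \<and> y \<in> V"
  unfolding reversed_def by blast

lemma reversed_sym: "reversed x y \<Longrightarrow> reversed y x"
  unfolding reversed_def by blast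

lemma linked_sym: "reversed\<^sup>*\<^sup>* x y \<Longrightarrow> reversed\<^sup>*\<^sup>* y x"
  by (induction rule: rtranclp_induct) (auto intro: reversed_sym converse_rtranclp_into_rtranclp)

lemma linked_in: "reversed\<^sup>*\<^sup>* x y \<Longrightarrow> x \<in> V \<Longrightarrow> y \<in> V"
  by (induction rule: rtranclp_induct) (auto dest: reversed_in)

lemma tournament_pair_subset:
  assumes W: "W \<subseteq> V"
  shows "tournament_pair W E F"
proof
  show "finite W" using W finite_V by (rule finite_subset)
  show "tournament_on W E" "tournament_on W F"
    using W tournament_E tournament_F tournament_on_subset by blast+
  fix a b c assume "a \<in> W" "b \<in> W" "c \<in> W"
  then have abc: "a \<in> V" "b \<in> V" "c \<in> V" using W by blast+
  show "cycle3 F a b c \<or> cycle3 F c b a" if "cycle3 E a b c"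
    using cycle_EF[OF abc that] .
  show "cycle3 E a b c \<or> cycle3 E c b a" if "cycle3 F a b c"
    using cycle_FE[OF abc that] .
  fix d assume "d \<in> W"
  then have d: "d \<in> V" using W by blast
  show "F d a" if "cycle3 E a b c" "E d a" "E d b" "E d c"
    using source_EF[OF abc d that] .
  show "F a d" if "cycle3 E a b c" "E a d" "E b d" "E c d"
    using sink_EF[OF abc d that] .
qed

lemma tournament_pair_conversep: "tournament_pair V E\<inverse>\<inverse> F\<inverse>\<inverse>"
proof
  show "finite V" by (rule finite_V)
  show "tournament_on V E\<inverse>\<inverse>" "tournament_on V F\<inverse>\<inverse>"
    by (intro tournament_on_conversep tournament_E tournament_F)+
  fix a b c assume abc: "a \<in> V" "b \<in> V" "c \<in> V"
  show "cycle3 F\<inverse>\<inverse> a b c \<or> cycle3 F\<inverse>\<inverse> c b a" if "cycle3 E\<inverse>\<inverse> a b c"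
    using cycle_EF[of c b a] abc that by (auto simp: cycle3_conversep)
  show "cycle3 E\<inverse>\<inverse> a b c \<or> cycle3 E\<inverse>\<inverse> c b a" if "cycle3 F\<inverse>\<inverse> a b c"
    using cycle_FE[of c b a] abc that by (auto simp: cycle3_conversep)
  fix d assume "d \<in> V"
  show "F\<inverse>\<inverse> d a" if "cycle3 E\<inverse>\<inverse> a b c" "E\<inverse>\<inverse> d a" "E\<inverse>\<inverse> d b" "E\<inverse>\<inverse> d c"
    using sink_EF[of a c b d] abc that \<open>d \<in> V\<close> by (auto simp: cycle3_def)
  show "F\<inverse>\<inverse> a d" if "cycle3 E\<inverse>\<inverse> a b c" "E\<inverse>\<inverse> a d" "E\<inverse>\<inverse> b d" "E\<inverse>\<inverse> c d"
    using source_EF[of a c b d] abc that \<open>d \<in> V\<close> by (auto simp: cycle3_def)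
qed

text \<open>If \<open>z\<close> separated \<open>x\<close> from \<open>y\<close>, the triple would
  be a 3-cycle in exactly one of the two tournaments, since only the arc between \<open>x\<close>
  and \<open>y\<close> differs.\<close>

lemma reversed_interval:
  assumes "reversed x y" "z \<in> V" "\<not> reversed x z" "\<not> reversed y z"
  shows "E x z \<longleftrightarrow> E y z"
proof -
  have x: "x \<in> V" and y: "y \<in> V"
    using reversed_in[OF assms(1)] by auto
  have ne: "x \<noteq> y" "x \<noteq> z" "y \<noteq> z"
    using assms reversed_sym reversed_flip[of x x] reversed_in x E_irrefl F_irrefl by metis+
  have "E z x \<longleftrightarrow> \<not> E x z" "E z y \<longleftrightarrow> \<not> E y z" "F z x \<longleftrightarrow> \<not> F x z" "F z y \<longleftrightarrow> \<not> F y z"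
    "E y x \<longleftrightarrow> \<not> E x y" "F y x \<longleftrightarrow> \<not> F x y"
    by (rule E_opp F_opp; use x y assms(2) ne in blast)+
  moreover have "E x z \<longleftrightarrow> F x z" "E y z \<longleftrightarrow> F y z"
    using calculation assms(2-4) x y unfolding reversed_def by blast+
  moreover have "E x y \<longleftrightarrow> \<not> F x y"
    by (rule reversed_flip[OF assms(1)])
  ultimately show ?thesis
    using cycle_EF[OF x y assms(2)] cycle_EF[OF y x assms(2)]
      cycle_FE[OF x y assms(2)] cycle_FE[OF y x assms(2)]
    unfolding cycle3_def by argo
qed

lemma linked_interval:
  assumes "reversed\<^sup>*\<^sup>* x y" "x \<in> V" "z \<in> V" "\<not> reversed\<^sup>*\<^sup>* x z"
  shows "E x z \<longleftrightarrow> E y z"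
  using assms(1)
proof (induction rule: rtranclp_induct)
  case (step u w)
  then have "\<not> reversed u z" "\<not> reversed w z"
    using assms(4) by (meson rtranclp.rtrancl_into_rtrancl)+
  then show ?case
    using step reversed_interval[of u w z] assms(3) by simp
qed simp

lemma not_linked_agree:
  assumes "x \<in> V" "z \<in> V" "\<not> reversed\<^sup>*\<^sup>* x z"
  shows "E x z \<longleftrightarrow> F x z"
proof -
  have "\<not> reversed x z" "x \<noteq> z" using assms(3) by auto
  then show ?thesis
    using E_iff[OF assms(1,2)] F_iff[OF assms(1,2)] assms(1,2) unfolding reversed_def by blast
qed

text \<open>Components are intervals and the tournaments agree between them, so isomorphisms chosen
  on the components combine freely.\<close>

lemma rel_iso_glue:
  assumes "\<And>x. x \<in> V \<Longrightarrow> rel_iso {y. reversed\<^sup>*\<^sup>* x y} E {y. reversed\<^sup>*\<^sup>* x y} F"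
  shows "rel_iso V E V F"
proof -
  let ?C = "\<lambda>x. {y. reversed\<^sup>*\<^sup>* x y}"
  let ?P = "\<lambda>C f. bij_betw f C C \<and> (\<forall>a\<in>C. \<forall>b\<in>C. E a b \<longleftrightarrow> F (f a) (f b))"
  \<comment> \<open>The choice depends on the class as a set, so that linked vertices are moved by
    the same isomorphism.\<close>
  define f where "f C = (SOME f. ?P C f)" for C
  have "?P (?C x) (f (?C x))" if "x \<in> V" for x
    using assms[OF that] unfolding rel_iso_def f_def by (rule someI_ex)
  then have f: "\<And>x. x \<in> V \<Longrightarrow> bij_betw (f (?C x)) (?C x) (?C x)"
      "\<And>x a b. x \<in> V \<Longrightarrow> a \<in> ?C x \<Longrightarrow> b \<in> ?C x \<Longrightarrow> E a b \<longleftrightarrow> F (f (?C x) a) (f (?C x) b)"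
    by blast+
  define g where "g x = f (?C x) x" for x
  have linked_g: "reversed\<^sup>*\<^sup>* x (g x)" if "x \<in> V" for x
    using bij_betwE[OF f(1)[OF that]] unfolding g_def by blast
  have same_class: "?C y = ?C x" if "reversed\<^sup>*\<^sup>* x y" for x y
    using that linked_sym by (auto intro: rtranclp_trans)
  have g_V: "g x \<in> V" if "x \<in> V" for x
    using linked_in linked_g that by blast
  have iff: "E x y \<longleftrightarrow> F (g x) (g y)" if xy: "x \<in> V" "y \<in> V" for x y
  proof (cases "reversed\<^sup>*\<^sup>* x y")
    case True
    then show ?thesis
      using f(2)[of x x y] xy same_class[OF True] unfolding g_def by simp
  next
    case False
    have 1: "\<not> reversed\<^sup>*\<^sup>* y (g x)" "\<not> reversed\<^sup>*\<^sup>* (g x) (g y)"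
      using False linked_g[OF xy(1)] linked_g[OF xy(2)] linked_sym by (meson rtranclp_trans)+
    \<comment> \<open>First \<open>x\<close> and then \<open>y\<close> moves inside its class; as
      classes are intervals, neither move changes the arc.\<close>
    have "E x y \<longleftrightarrow> E (g x) y"
      using linked_interval[OF linked_g[OF xy(1)]] xy False by blast
    also have "\<dots> \<longleftrightarrow> \<not> E y (g x)"
      using E_iff[OF g_V[OF xy(1)] xy(2)] 1 by auto
    also have "\<dots> \<longleftrightarrow> \<not> E (g y) (g x)"
      using linked_interval[OF linked_g[OF xy(2)] xy(2) g_V[OF xy(1)] 1(1)] by blast
    also have "\<dots> \<longleftrightarrow> E (g x) (g y)"
      using E_iff[OF g_V[OF xy(1)] g_V[OF xy(2)]] 1 by auto
    also have "\<dots> \<longleftrightarrow> F (g x) (g y)"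
      using not_linked_agree g_V xy 1 by blast
    finally show ?thesis .
  qed
  have inj: "inj_on g V"
    using iff E_opp F_irrefl g_V by (intro inj_onI) metis
  have "g ` V = V"
    using g_V inj finite_V by (intro card_subset_eq) (auto simp: card_image)
  then show ?thesis
    unfolding rel_iso_def using iff inj by (intro exI[of _ g]) (auto simp: bij_betw_def)
qed

text \<open>
  A strong 4-tournament has exactly two 3-cycles, which share an arc and together contain all
  arcs but one. If both are kept, only the remaining arc can be reversed, and its ends are twins.
\<close>
lemma kept_cycle_step:
  assumes "cycle3 E a b c" "cycle3 F a b c" "reversed a e" "b \<in> V" "c \<in> V"
  shows "cycle3 E e b c \<and> cycle3 F e b c"
proof -
  have a: "a \<in> V" and e: "e \<in> V"
    using reversed_in[OF assms(3)] by auto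
  note V = a assms(4,5) e
  note flip = reversed_flip[OF assms(3)]
  have ne: "e \<noteq> a" "e \<noteq> b" "e \<noteq> c" "a \<noteq> b" "b \<noteq> c" "c \<noteq> a"
    using assms(1,2) V flip E_irrefl F_irrefl E_asym F_asym unfolding cycle3_def by metis+
  have "E a e \<longleftrightarrow> \<not> E e a" "E b e \<longleftrightarrow> \<not> E e b" "E c e \<longleftrightarrow> \<not> E e c"
    "F a e \<longleftrightarrow> \<not> F e a" "F b e \<longleftrightarrow> \<not> F e b" "F c e \<longleftrightarrow> \<not> F e c"
    "E a b \<longleftrightarrow> \<not> E b a" "E b c \<longleftrightarrow> \<not> E c b" "E c a \<longleftrightarrow> \<not> E a c"
    "F a b \<longleftrightarrow> \<not> F b a" "F b c \<longleftrightarrow> \<not> F c b" "F c a \<longleftrightarrow> \<not> F a c"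
    by (rule E_opp F_opp; use V ne in blast)+
  then show ?thesis
    using assms(1,2) V flip
      cycle_EF[of e b c] cycle_EF[of e c a] cycle_EF[of e a b]
      cycle_EF[of e c b] cycle_EF[of e a c] cycle_EF[of e b a]
      source_EF[of a b c e] sink_EF[of a b c e]
    unfolding cycle3_def by argo
qed

text \<open>By \<open>kept_cycle_step\<close> every vertex linked to \<open>a\<close> can replace it
  in the 3-cycle; if \<open>b\<close> were one, it would carry a loop.\<close>

lemma kept_cycle_not_linked:
  assumes "cycle3 E a b c" "cycle3 F a b c" "a \<in> V" "b \<in> V" "c \<in> V"
  shows "\<not> reversed\<^sup>*\<^sup>* a b"
proof
  assume "reversed\<^sup>*\<^sup>* a b"
  moreover have "cycle3 E e b c \<and> cycle3 F e b c" if "reversed\<^sup>*\<^sup>* a e" for e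
    using that
  proof (induction rule: rtranclp_induct)
    case (step e f)
    then show ?case
      using kept_cycle_step[of e b c f] assms(4,5) by blast
  qed (use assms(1,2) in blast)
  ultimately show False
    using E_irrefl[OF assms(4)] unfolding cycle3_def by blast
qed

lemma linked_cycle_reversed:
  assumes "cycle3 E a b c" "a \<in> V" "b \<in> V" "c \<in> V" "reversed\<^sup>*\<^sup>* a b"
  shows "cycle3 F c b a"
  using assms kept_cycle_not_linked cycle_EF by blast

text \<open>In the tournament where \<open>e\<close> dominates \<open>d\<close>, a cycle vertex
  dominating \<open>e\<close> would form a 3-cycle with \<open>d\<close> and \<open>e\<close>. The
  other tournament would contain it in the same direction, since \<open>d\<close> dominates the
  cycle in both, against the reversed arc. So \<open>e\<close> dominates the cycle there, and the
  source, sink and 3-cycle axioms carry this over.\<close>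

lemma source_step:
  assumes "cycle3 E a b c" "cycle3 F c b a" "a \<in> V" "b \<in> V" "c \<in> V"
    and "E d a" "E d b" "E d c" "F d a" "F d b" "F d c" "reversed d e"
  shows "E e a \<and> E e b \<and> E e c \<and> F e a \<and> F e b \<and> F e c"
proof -
  have d: "d \<in> V" and e: "e \<in> V"
    using reversed_in[OF assms(12)] by auto
  note V = assms(3-5) d e
  note flip = reversed_flip[OF assms(12)]
  have ne: "e \<noteq> a" "e \<noteq> b" "e \<noteq> c" "e \<noteq> d"
    using assms(6-11) V flip E_irrefl F_irrefl by metis+
  have "E a e \<longleftrightarrow> \<not> E e a" "E b e \<longleftrightarrow> \<not> E e b" "E c e \<longleftrightarrow> \<not> E e c" "E d e \<longleftrightarrow> \<not> E e d"
    "F a e \<longleftrightarrow> \<not> F e a" "F b e \<longleftrightarrow> \<not> F e b" "F c e \<longleftrightarrow> \<not> F e c" "F d e \<longleftrightarrow> \<not> F e d"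
    by (rule E_opp F_opp; use V ne in blast)+
  moreover have "\<not> E a d" "\<not> E b d" "\<not> E c d" "\<not> F a d" "\<not> F b d" "\<not> F c d"
    by (rule E_asym F_asym; use V assms(6-11) in blast)+
  moreover have "\<not> E b a" "\<not> E c b" "\<not> E a c" "\<not> F a b" "\<not> F b c" "\<not> F c a"
    by (rule E_asym F_asym; use V assms(1,2) in \<open>simp add: cycle3_def\<close>)+
  ultimately show ?thesis
    using assms(1,2,6-11) V flip
      cycle_EF[of e b c] cycle_EF[of e c a] cycle_EF[of e a b]
      cycle_EF[of d a e] cycle_EF[of d b e] cycle_EF[of d c e]
      cycle_FE[of d a e] cycle_FE[of d b e] cycle_FE[of d c e]
      source_EF[of a b c e] source_EF[of b c a e] source_EF[of c a b e]
      sink_EF[of a b c e] sink_EF[of b c a e] sink_EF[of c a b e]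
    unfolding cycle3_def by argo
qed

text \<open>By \<open>source_step\<close>, dominating the cycle spreads from \<open>d\<close> to
  everything linked to it; reaching \<open>a\<close> would give a loop.\<close>

lemma source_not_linked:
  assumes "cycle3 E a b c" "a \<in> V" "b \<in> V" "c \<in> V" "d \<in> V" "E d a" "E d b" "E d c"
    "reversed\<^sup>*\<^sup>* a b"
  shows "\<not> reversed\<^sup>*\<^sup>* d a"
proof
  assume "reversed\<^sup>*\<^sup>* d a"
  moreover have "E e a \<and> E e b \<and> E e c \<and> F e a \<and> F e b \<and> F e c" if "reversed\<^sup>*\<^sup>* d e" for e
    using that
  proof (induction rule: rtranclp_induct)
    case base
    show ?case
      using assms(1-8) source_EF[of a b c d] source_EF[of b c a d] source_EF[of c a b d]
      unfolding cycle3_def by blast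
  next
    case (step e f)
    then show ?case
      using source_step[OF assms(1) linked_cycle_reversed[OF assms(1-4,9)] assms(2-4), of e f]
      by blast
  qed
  ultimately show False
    using E_irrefl[OF assms(2)] by blast
qed

lemma reversed_conversep: "tournament_pair.reversed V E\<inverse>\<inverse> F\<inverse>\<inverse> = reversed"
  unfolding tournament_pair.reversed_def[OF tournament_pair_conversep] reversed_def[abs_def]
  by (intro ext) auto

text \<open>Dual to \<open>source_not_linked\<close>; in the converse the cycle reads
  \<open>a\<close>, \<open>c\<close>, \<open>b\<close>, whence the link between \<open>a\<close> and
  \<open>c\<close>.\<close>

lemma sink_not_linked:
  assumes "cycle3 E a b c" "a \<in> V" "b \<in> V" "c \<in> V" "d \<in> V" "E a d" "E b d" "E c d"
    "reversed\<^sup>*\<^sup>* a c"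
  shows "\<not> reversed\<^sup>*\<^sup>* d a"
  using tournament_pair.source_not_linked[OF tournament_pair_conversep, of a c b d] assms
  unfolding reversed_conversep by (auto simp: cycle3_def)

text \<open>A kept 3-cycle cannot lie in a component, so on each component both tournaments are
  linear orders of the same size.\<close>

lemma kept_cycles_imp_iso:
  assumes kept: "\<And>a b c. \<lbrakk>a \<in> V; b \<in> V; c \<in> V; cycle3 E a b c\<rbrakk> \<Longrightarrow> cycle3 F a b c"
  shows "rel_iso V E V F"
proof (rule rel_iso_glue)
  fix x assume "x \<in> V"
  let ?C = "{y. reversed\<^sup>*\<^sup>* x y}"
  have C: "?C \<subseteq> V" using linked_in \<open>x \<in> V\<close> by blast
  have linked: "reversed\<^sup>*\<^sup>* a b" if "a \<in> ?C" "b \<in> ?C" for a b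
    using that linked_sym rtranclp_trans[of reversed a x b] by blast
  have no_E: "\<not> cycle3 E a b c" if "a \<in> ?C" "b \<in> ?C" "c \<in> ?C" for a b c
    using kept_cycle_not_linked[of a b c] kept[of a b c] linked[of a b] C that by blast
  have no_F: "\<not> cycle3 F a b c" if "a \<in> ?C" "b \<in> ?C" "c \<in> ?C" for a b c
    using no_E[of a b c] no_E[of c b a] cycle_FE[of a b c] C that by blast
  have "rel_iso ?C E {..<card ?C} (<)"
    using C finite_V tournament_E no_E
    by (intro acyclic_tournament_imp_linear) (auto intro: finite_subset tournament_on_subset)
  moreover have "rel_iso ?C F {..<card ?C} (<)"
    using C finite_V tournament_F no_F
    by (intro acyclic_tournament_imp_linear) (auto intro: finite_subset tournament_on_subset)
  ultimately show "rel_iso ?C E ?C F"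
    using rel_iso_sym rel_iso_trans by blast
qed

text \<open>Isolates what the argument uses of \<open>beta6_arc\<close>, here \<open>B\<close> on
  \<open>U\<close>. Inside a component \<open>F\<close> is isomorphic to the dual of
  \<open>E\<close>, which keeps \<open>B\<close> and its dual out of \<open>E\<close>; self-duality
  of \<open>E\<close> then gives the isomorphism with \<open>F\<close>.\<close>

lemma rel_iso_of_link_class:
  fixes U :: "'b set" and B :: "'b \<Rightarrow> 'b \<Rightarrow> bool"
  assumes same: "\<And>S. S \<subseteq> V \<Longrightarrow> card S = card U \<Longrightarrow> rel_iso S E U B \<longleftrightarrow> rel_iso S F U B"
    and not_self_dual: "\<not> rel_iso U B U B\<inverse>\<inverse>"
    and self_dual: "\<And>C. \<lbrakk>C \<subseteq> V;
        \<And>a b c d. \<lbrakk>a \<in> C; b \<in> C; c \<in> C; d \<in> C; cycle3 E a b c\<rbrakk> \<Longrightarrow> \<not> (E d a \<and> E d b \<and> E d c);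
        \<And>a b c d. \<lbrakk>a \<in> C; b \<in> C; c \<in> C; d \<in> C; cycle3 E a b c\<rbrakk> \<Longrightarrow> \<not> (E a d \<and> E b d \<and> E c d);
        \<And>S. S \<subseteq> C \<Longrightarrow> \<not> rel_iso S E U B;
        \<And>S. S \<subseteq> C \<Longrightarrow> \<not> rel_iso S E U B\<inverse>\<inverse>\<rbrakk> \<Longrightarrow> rel_iso C E C E\<inverse>\<inverse>"
    and "x \<in> V"
  shows "rel_iso {y. reversed\<^sup>*\<^sup>* x y} E {y. reversed\<^sup>*\<^sup>* x y} F"
proof -
  let ?C = "{y. reversed\<^sup>*\<^sup>* x y}"
  have C: "a \<in> V" if "a \<in> ?C" for a using linked_in that \<open>x \<in> V\<close> by blast
  have linked: "reversed\<^sup>*\<^sup>* a b" if "a \<in> ?C" "b \<in> ?C" for a b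
    using that linked_sym rtranclp_trans[of reversed a x b] by blast
  have source: "\<not> (E d a \<and> E d b \<and> E d c)"
    if "a \<in> ?C" "b \<in> ?C" "c \<in> ?C" "d \<in> ?C" "cycle3 E a b c" for a b c d
    using source_not_linked[of a b c d] linked[of a b] linked[of d a] C that by blast
  have sink: "\<not> (E a d \<and> E b d \<and> E c d)"
    if "a \<in> ?C" "b \<in> ?C" "c \<in> ?C" "d \<in> ?C" "cycle3 E a b c" for a b c d
    using sink_not_linked[of a b c d] linked[of a c] linked[of d a] C that by blast
  have rev: "cycle3 F c b a" if "a \<in> ?C" "b \<in> ?C" "c \<in> ?C" "cycle3 E a b c" for a b c
    using linked_cycle_reversed[of a b c] linked[of a b] C that by blast
  have dual: "rel_iso S E\<inverse>\<inverse> S F" if S: "S \<subseteq> ?C" for S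
  proof -
    have SV: "S \<subseteq> V" using S C by blast
    \<comment> \<open>On the class, \<open>F\<close> contains the 3-cycles of the dual of
      \<open>E\<close> in the same direction, and the source and sink axioms hold vacuously for want
      of diamonds.\<close>
    interpret dual: tournament_pair S "E\<inverse>\<inverse>" F
    proof
      show "finite S" using finite_V SV by (rule finite_subset[rotated])
      show "tournament_on S E\<inverse>\<inverse>" "tournament_on S F"
        using tournament_E tournament_F SV tournament_on_conversep tournament_on_subset by blast+
      fix a b c assume abc: "a \<in> S" "b \<in> S" "c \<in> S"
      show "cycle3 F a b c \<or> cycle3 F c b a" if "cycle3 E\<inverse>\<inverse> a b c"
        using rev[of c b a] abc S that unfolding cycle3_conversep by blast
      show "cycle3 E\<inverse>\<inverse> a b c \<or> cycle3 E\<inverse>\<inverse> c b a" if "cycle3 F a b c"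
        using cycle_FE[of a b c] abc SV that unfolding cycle3_conversep by blast
      fix d assume d: "d \<in> S"
      show "F d a" if "cycle3 E\<inverse>\<inverse> a b c" "E\<inverse>\<inverse> d a" "E\<inverse>\<inverse> d b" "E\<inverse>\<inverse> d c"
        using sink[of c b a d] abc d S that unfolding cycle3_conversep conversep_iff by blast
      show "F a d" if "cycle3 E\<inverse>\<inverse> a b c" "E\<inverse>\<inverse> a d" "E\<inverse>\<inverse> b d" "E\<inverse>\<inverse> c d"
        using source[of c b a d] abc d S that unfolding cycle3_conversep conversep_iff by blast
    qed
    show ?thesis
      using rev S by (intro dual.kept_cycles_imp_iso) (auto simp: cycle3_conversep)
  qed
  \<comment> \<open>A copy of \<open>B\<close> in both tournaments would make \<open>B\<close>
    isomorphic to its dual.\<close>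
  have "\<not> (rel_iso S E U B \<and> rel_iso S F U B)" if S: "S \<subseteq> ?C" for S
    using rel_iso_conversep[of S E U B] dual[OF S] not_self_dual rel_iso_sym rel_iso_trans by meson
  then have no_B: "\<not> rel_iso S E U B" if "S \<subseteq> ?C" for S
    using same[of S] that C rel_iso_card[of S E U B] by blast
  \<comment> \<open>A copy of the dual of \<open>B\<close> in \<open>E\<close> is a copy of
    \<open>B\<close> in \<open>F\<close>, which \<open>same\<close> transfers back to
    \<open>E\<close>.\<close>
  have no_B': "\<not> rel_iso S E U B\<inverse>\<inverse>" if S: "S \<subseteq> ?C" for S
  proof
    assume "rel_iso S E U B\<inverse>\<inverse>"
    then have "rel_iso S E\<inverse>\<inverse> U B" "card S = card U"
      using rel_iso_conversep[of S E U "B\<inverse>\<inverse>"] rel_iso_card by auto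
    then have "rel_iso S E U B"
      using dual[OF S] same[of S] S C rel_iso_sym rel_iso_trans by (meson subsetD subsetI)
    then show False using no_B[OF S] by blast
  qed
  have "rel_iso ?C E ?C E\<inverse>\<inverse>"
    using C source sink no_B no_B' by (intro self_dual) auto
  then show ?thesis
    using dual[of ?C] rel_iso_trans by blast
qed

end

section \<open>Diamond-free tournaments as binary words\<close>

text \<open>The arcs of \<open>beta6_plus\<close> in the relational form that \<open>rel_iso\<close>
  takes; \<open>beta6_arc_eq\<close> relates the two.\<close>

definition beta6_arc :: "nat \<Rightarrow> nat \<Rightarrow> bool" where
  "beta6_arc x y \<longleftrightarrow> (x, y) \<in> {(0, 1), (0, 2), (1, 2), (3, 4)}
     \<union> {0, 1, 2} \<times> {3, 4} \<union> {3, 4} \<times> {5} \<union> {5} \<times> {0, 1, 2}"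

lemma rel_iso_restrict:
  assumes "rel_iso V E W F" "S \<subseteq> W"
  shows "\<exists>S'\<subseteq>V. rel_iso S' E S F"
proof -
  obtain f where f: "bij_betw f W V" "\<forall>x\<in>W. \<forall>y\<in>W. F x y \<longleftrightarrow> E (f x) (f y)"
    using rel_iso_sym[OF assms(1)] unfolding rel_iso_def by blast
  have bij: "bij_betw f S (f ` S)"
    using f(1) assms(2) by (rule bij_betw_subset) simp
  have "F x y \<longleftrightarrow> E (f x) (f y)" if "x \<in> S" "y \<in> S" for x y
    using f(2) assms(2) that by blast
  then have "rel_iso S F (f ` S) E"
    unfolding rel_iso_def using bij by blast
  moreover have "f ` S \<subseteq> V"
    using bij_betw_imp_surj_on[OF f(1)] assms(2) by blast
  ultimately show ?thesis
    by (meson rel_iso_sym)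
qed

text \<open>The switch of the linear order of positions along the set of positions carrying
  \<open>True\<close>.\<close>

definition word_arc :: "bool list \<Rightarrow> nat \<Rightarrow> nat \<Rightarrow> bool" where
  "word_arc w i j \<longleftrightarrow> i \<noteq> j \<and> (i < j \<longleftrightarrow> w ! i = w ! j)"

definition word_iso :: "bool list \<Rightarrow> bool list \<Rightarrow> bool" where
  "word_iso u w \<longleftrightarrow> rel_iso {..<length u} (word_arc u) {..<length w} (word_arc w)"

lemma word_iso_refl: "word_iso w w"
  unfolding word_iso_def by (rule rel_iso_refl)

lemma word_iso_sym: "word_iso u w \<Longrightarrow> word_iso w u"
  unfolding word_iso_def by (rule rel_iso_sym)

lemma word_iso_trans: "word_iso u v \<Longrightarrow> word_iso v w \<Longrightarrow> word_iso u w"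
  unfolding word_iso_def by (rule rel_iso_trans)

text \<open>Moving \<open>x\<close> behind \<open>y\<close> turns around the position order between
  the two parts; negating the letters of \<open>x\<close> compensates.\<close>

lemma word_iso_rotate: "word_iso (x @ y) (y @ map Not x)"
proof -
  let ?f = "\<lambda>i. if i < length x then length y + i else i - length x"
  let ?g = "\<lambda>i. if i < length y then length x + i else i - length y"
  have "bij_betw ?f {..<length (x @ y)} {..<length (y @ map Not x)}"
    by (rule bij_betw_byWitness[of _ ?g]) (auto split: if_splits)
  moreover have "word_arc (x @ y) i j \<longleftrightarrow> word_arc (y @ map Not x) (?f i) (?f j)"
    if "i < length (x @ y)" "j < length (x @ y)" for i j
    using that unfolding word_arc_def by (auto simp: nth_append)
  ultimately show ?thesis
    unfolding word_iso_def rel_iso_def by blast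
qed

lemma word_iso_map_Not: "word_iso (map Not w) w"
  unfolding word_iso_def length_map by (rule rel_iso_cong) (auto simp: word_arc_def)

lemma word_arc_rev: "rel_iso {..<length w} (word_arc (rev w)) {..<length w} (word_arc w)\<inverse>\<inverse>"
proof -
  let ?f = "\<lambda>i. length w - 1 - i"
  have "bij_betw ?f {..<length w} {..<length w}"
    by (rule bij_betw_byWitness[of _ ?f]) auto
  moreover have "word_arc (rev w) i j \<longleftrightarrow> (word_arc w)\<inverse>\<inverse> (?f i) (?f j)"
    if "i < length w" "j < length w" for i j
    using that unfolding word_arc_def by (auto simp: rev_nth)
  ultimately show ?thesis
    unfolding rel_iso_def by blast
qed

lemma word_iso_rev_imp_self_dual:
  assumes "word_iso w (rev w)"
  shows "rel_iso {..<length w} (word_arc w) {..<length w} (word_arc w)\<inverse>\<inverse>"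
  using assms word_arc_rev rel_iso_trans unfolding word_iso_def length_rev by blast

text \<open>
  Reversing all arcs between the in-neighbours of a vertex \<open>x\<close> and the other vertices makes \<open>x\<close> a
  source and creates no 3-cycle; the letters of the word record the two sides of this switch.
\<close>
lemma diamond_free_imp_word:
  assumes "finite C" and tour: "tournament_on C E"
    and source: "\<And>a b c d. \<lbrakk>a \<in> C; b \<in> C; c \<in> C; d \<in> C; cycle3 E a b c\<rbrakk> \<Longrightarrow> \<not> (E d a \<and> E d b \<and> E d c)"
    and sink: "\<And>a b c d. \<lbrakk>a \<in> C; b \<in> C; c \<in> C; d \<in> C; cycle3 E a b c\<rbrakk> \<Longrightarrow> \<not> (E a d \<and> E b d \<and> E c d)"
  obtains w where "rel_iso C E {..<length w} (word_arc w)"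
proof (cases "C = {}")
  case True
  then have "rel_iso C E {..<length []} (word_arc [])"
    unfolding rel_iso_def by (simp add: bij_betw_def)
  then show ?thesis by (rule that)
next
  case False
  then obtain x where x: "x \<in> C" by blast
  have opp: "E y z \<longleftrightarrow> \<not> E z y" if "y \<in> C" "z \<in> C" "y \<noteq> z" for y z
    using tournament_onD[OF tour that(1,2)] that(3) by blast
  \<comment> \<open>In the definition of \<open>s\<close> that follows, counting \<open>x\<close>
    among its own out-neighbours makes it a source of \<open>D\<close>.\<close>
  have irrefl: "\<not> E y y" if "y \<in> C" for y
    using tournament_onD[OF tour that that] by blast
  define s where "s y \<longleftrightarrow> y = x \<or> E x y" for y
  define D where "D y z \<longleftrightarrow> (if s y = s z then E y z else E z y)" for y z
  have D_opp: "D y z \<longleftrightarrow> \<not> D z y" if "y \<in> C" "z \<in> C" "y \<noteq> z" for y z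
    using opp[OF that] unfolding D_def by auto
  have D_irrefl: "\<not> D y y" if "y \<in> C" for y
    using irrefl[OF that] unfolding D_def by auto
  have tour_D: "tournament_on C D"
    unfolding tournament_on_def using D_opp D_irrefl by metis
  have D_x: "\<not> D y x" if "y \<in> C" for y
    using opp[of x y] irrefl[of y] x that unfolding D_def s_def by auto
  have acyclic: "\<not> cycle3 D a b c" if abc: "a \<in> C" "b \<in> C" "c \<in> C" for a b c
  proof
    assume cyc: "cycle3 D a b c"
    then have ne: "a \<noteq> x" "b \<noteq> x" "c \<noteq> x" "a \<noteq> b" "b \<noteq> c" "c \<noteq> a"
      using D_x D_irrefl abc unfolding cycle3_def by blast+
    note V = x abc
    have "E a x \<longleftrightarrow> \<not> E x a" "E b x \<longleftrightarrow> \<not> E x b" "E c x \<longleftrightarrow> \<not> E x c"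
      "E a b \<longleftrightarrow> \<not> E b a" "E b c \<longleftrightarrow> \<not> E c b" "E c a \<longleftrightarrow> \<not> E a c"
      by (rule opp; use V ne in blast)+
    moreover have "s a \<longleftrightarrow> E x a" "s b \<longleftrightarrow> E x b" "s c \<longleftrightarrow> E x c"
      using ne unfolding s_def by blast+
    moreover have "if s a = s b then E a b else E b a" "if s b = s c then E b c else E c b"
      "if s c = s a then E c a else E a c"
      using cyc unfolding cycle3_def D_def by blast+
    \<comment> \<open>If the three letters are equal, \<open>a\<close>, \<open>b\<close>,
      \<open>c\<close> form a 3-cycle of \<open>E\<close> with \<open>x\<close> as source or sink.
      Otherwise \<open>x\<close> forms a 3-cycle with two of them, and the third is its source or
      sink.\<close>
    ultimately show False
      using source[OF abc x] source[OF abc(3,2,1) x] source[OF x abc] source[OF x abc(2,1,3)]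
        source[OF x abc(2,3,1)] source[OF x abc(3,2,1)] source[OF x abc(3,1,2)] source[OF x abc(1,3,2)]
        sink[OF abc x] sink[OF abc(3,2,1) x] sink[OF x abc] sink[OF x abc(2,1,3)]
        sink[OF x abc(2,3,1)] sink[OF x abc(3,2,1)] sink[OF x abc(3,1,2)] sink[OF x abc(1,3,2)]
      unfolding cycle3_def by argo
  qed
  obtain f where f: "bij_betw f C {..<card C}" "\<forall>y\<in>C. \<forall>z\<in>C. D y z \<longleftrightarrow> f y < f z"
    using acyclic_tournament_imp_linear[OF assms(1) tour_D acyclic] unfolding rel_iso_def by blast
  define w where "w = map (s \<circ> inv_into C f) [0..<card C]"
  have len: "length w = card C" unfolding w_def by simp
  have w: "w ! f y \<longleftrightarrow> s y" if "y \<in> C" for y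
    using that bij_betwE[OF f(1)] f(1) unfolding w_def by (auto simp: bij_betw_inv_into_left)
  have "E y z \<longleftrightarrow> word_arc w (f y) (f z)" if yz: "y \<in> C" "z \<in> C" for y z
  proof (cases "y = z")
    case True
    then show ?thesis using irrefl yz unfolding word_arc_def by simp
  next
    case False
    then have ne: "f y \<noteq> f z"
      using f(1) yz unfolding bij_betw_def inj_on_def by blast
    have "E y z \<longleftrightarrow> (if s y = s z then D y z else D z y)"
      unfolding D_def by auto
    also have "\<dots> \<longleftrightarrow> (if s y = s z then f y < f z else \<not> f y < f z)"
      using f(2) yz ne by auto
    finally show ?thesis
      unfolding word_arc_def w[OF yz(1)] w[OF yz(2)] using ne by auto
  qed
  then have "rel_iso C E {..<length w} (word_arc w)"
    unfolding rel_iso_def len using f(1) by blast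
  then show ?thesis by (rule that)
qed

section \<open>Subsequences as induced subtournaments\<close>

lemma subseq_imp_index_map:
  assumes "subseq u w"
  shows "\<exists>f. (\<forall>i j. i < j \<longrightarrow> j < length u \<longrightarrow> f i < f j) \<and> (\<forall>i<length u. f i < length w \<and> w ! f i = u ! i)"
  using assms
proof (induction rule: list_emb.induct)
  case (list_emb_Nil ys)
  then show ?case by simp
next
  case (list_emb_Cons xs ys y)
  then obtain f where f: "\<forall>i j. i < j \<longrightarrow> j < length xs \<longrightarrow> f i < f j"
      "\<forall>i<length xs. f i < length ys \<and> ys ! f i = xs ! i"
    by blast
  then show ?case
    by (intro exI[of _ "Suc \<circ> f"]) auto
next
  case (list_emb_Cons2 x y xs ys)
  then obtain f where f: "\<forall>i j. i < j \<longrightarrow> j < length xs \<longrightarrow> f i < f j"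
      "\<forall>i<length xs. f i < length ys \<and> ys ! f i = xs ! i"
    by blast
  then show ?case
    using list_emb_Cons2(1)
    by (intro exI[of _ "case_nat 0 (Suc \<circ> f)"]) (auto split: nat.splits simp: nth_Cons)
qed

lemma subseq_imp_word_embedding:
  assumes "subseq u w"
  shows "\<exists>S\<subseteq>{..<length w}. rel_iso S (word_arc w) {..<length u} (word_arc u)"
proof -
  obtain f where f: "\<And>i j. i < j \<Longrightarrow> j < length u \<Longrightarrow> f i < f j"
      "\<And>i. i < length u \<Longrightarrow> f i < length w \<and> w ! f i = u ! i"
    using subseq_imp_index_map[OF assms] by blast
  have lt: "f i < f j \<longleftrightarrow> i < j" if "i < length u" "j < length u" for i j
    using f(1)[of i j] f(1)[of j i] that by (cases i j rule: linorder_cases) auto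
  have "inj_on f {..<length u}"
    using lt by (intro inj_onI) (metis lessThan_iff less_irrefl linorder_neqE_nat)
  then have "bij_betw f {..<length u} (f ` {..<length u})"
    by (rule inj_on_imp_bij_betw)
  moreover have "word_arc u i j \<longleftrightarrow> word_arc w (f i) (f j)" if "i < length u" "j < length u" for i j
    using lt[OF that] lt[OF that(2,1)] f(2)[OF that(1)] f(2)[OF that(2)] unfolding word_arc_def
    by auto
  ultimately have "rel_iso {..<length u} (word_arc u) (f ` {..<length u}) (word_arc w)"
    unfolding rel_iso_def by blast
  moreover have "f ` {..<length u} \<subseteq> {..<length w}"
    using f(2) by auto
  ultimately show ?thesis
    by (meson rel_iso_sym)
qed

text \<open>One letter of \<open>word_iso_rotate\<close>. On a nonempty word of length
  \<open>n\<close>, \<open>n\<close> steps negate the word and \<open>2 * n\<close> steps restore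
  it, so \<open>2 * n\<close> iterates exhaust the orbit; hence the bound 12 for six
  letters.\<close>

definition neg_rotate :: "bool list \<Rightarrow> bool list" where
  "neg_rotate w = tl w @ [\<not> hd w]"

lemma word_iso_neg_rotate_power:
  assumes "w \<noteq> []"
  shows "word_iso w ((neg_rotate ^^ i) w)"
proof -
  have "(neg_rotate ^^ i) w \<noteq> [] \<and> word_iso w ((neg_rotate ^^ i) w)"
  proof (induction i)
    case 0
    show ?case using assms word_iso_refl by simp
  next
    case (Suc i)
    let ?v = "(neg_rotate ^^ i) w"
    have "word_iso ?v (neg_rotate ?v)"
      using word_iso_rotate[of "[hd ?v]" "tl ?v"] Suc by (simp add: neg_rotate_def)
    then have "word_iso w (neg_rotate ?v)"
      using word_iso_trans Suc.IH by blast
    moreover have "neg_rotate ?v \<noteq> []"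
      by (simp add: neg_rotate_def)
    ultimately show ?case
      by simp
  qed
  then show ?thesis ..
qed

text \<open>
  The runs of \<open>+++-++\<close> have lengths 3, 1, 2 and are the three chains of \<open>beta6_arc\<close>; the reversed
  word gives its dual.
\<close>
definition beta6_words :: "bool list list" where
  "beta6_words = [(neg_rotate ^^ i) w. w \<leftarrow> [[True, True, True, False, True, True],
     [True, True, False, True, True, True]], i \<leftarrow> [0..<12]]"

lemma beta6_word_iso:
  assumes "b \<in> set beta6_words"
  shows "rel_iso {..<length b} (word_arc b) {0, 1, 2, 3, 4, 5} beta6_arc \<or>
    rel_iso {..<length b} (word_arc b) {0, 1, 2, 3, 4, 5} beta6_arc\<inverse>\<inverse>"
proof -
  \<comment> \<open>The single \<open>False\<close>, at position 3, becomes vertex 5; positions 4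
    and 5 become vertices 3 and 4.\<close>
  let ?w = "[True, True, True, False, True, True]" and ?f = "\<lambda>i. [0, 1, 2, 5, 3, 4] ! i :: nat"
  have V: "{..<length ?w} = {0, 1, 2, 3, 4, 5}" by auto
  have "bij_betw ?f {0, 1, 2, 3, 4, 5} {0, 1, 2, 3, 4, 5}"
    by (simp add: bij_betw_def insert_commute)
  moreover have "\<forall>i\<in>set [0, 1, 2, 3, 4, 5]. \<forall>j\<in>set [0, 1, 2, 3, 4, 5].
      word_arc ?w i j \<longleftrightarrow> beta6_arc (?f i) (?f j)"
    by code_simp
  ultimately have base: "rel_iso {..<length ?w} (word_arc ?w) {0, 1, 2, 3, 4, 5} beta6_arc"
    unfolding V rel_iso_def by (intro exI[of _ ?f] conjI) simp_all
  then have base': "rel_iso {..<length (rev ?w)} (word_arc (rev ?w)) {0, 1, 2, 3, 4, 5} beta6_arc\<inverse>\<inverse>"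
    using rel_iso_trans[OF word_arc_rev rel_iso_conversep[OF base]] by simp
  obtain i where "b = (neg_rotate ^^ i) ?w \<or> b = (neg_rotate ^^ i) (rev ?w)"
    using assms unfolding beta6_words_def by auto
  then have "word_iso b ?w \<or> word_iso b (rev ?w)"
    using word_iso_neg_rotate_power[of ?w i] word_iso_neg_rotate_power[of "rev ?w" i] word_iso_sym
    by auto
  then show ?thesis
    using base base' rel_iso_trans unfolding word_iso_def by blast
qed

lemma beta6_arc_code [code]:
  "beta6_arc x y \<longleftrightarrow> (x, y) \<in> set [(0, 1), (0, 2), (1, 2), (3, 4), (0, 3), (0, 4), (1, 3), (1, 4),
     (2, 3), (2, 4), (3, 5), (4, 5), (5, 0), (5, 1), (5, 2)]"
  unfolding beta6_arc_def by auto

text \<open>Dualizing turns the cyclic pattern of chains of lengths 3, 2, 1 into 3, 1, 2. The proof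
  searches all images \<open>a\<close>, \<open>b\<close>, \<open>c\<close>, \<open>d\<close>,
  \<open>e\<close>, \<open>g\<close> of the vertices 0 to 5, adding one vertex at a time.\<close>

lemma beta6_arc_not_self_dual:
  "\<not> rel_iso {0, 1, 2, 3, 4, 5} beta6_arc {0, 1, 2, 3, 4, 5} beta6_arc\<inverse>\<inverse>"
proof
  let ?L = "[0, 1, 2, 3, 4, 5] :: nat list"
  define V :: "nat set" where "V = set ?L"
  assume "rel_iso {0, 1, 2, 3, 4, 5} beta6_arc {0, 1, 2, 3, 4, 5} beta6_arc\<inverse>\<inverse>"
  then have "rel_iso V beta6_arc V beta6_arc\<inverse>\<inverse>"
    unfolding V_def by simp
  then obtain f where bij: "bij_betw f V V"
    and f: "\<And>x y. x \<in> V \<Longrightarrow> y \<in> V \<Longrightarrow> beta6_arc x y \<Longrightarrow> beta6_arc (f y) (f x)"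
    unfolding rel_iso_def conversep_iff by blast
  have in_V: "f x \<in> set ?L" if "x \<in> V" for x
    using bij_betwE[OF bij] that unfolding V_def by blast
  \<comment> \<open>\<open>if\<close> rather than implication, since its untaken branch is not evaluated\<close>
  have none: "\<forall>a\<in>set ?L. \<forall>b\<in>set ?L. if \<not> beta6_arc b a then True else
      (\<forall>c\<in>set ?L. if \<not> (beta6_arc c a \<and> beta6_arc c b) then True else
      (\<forall>d\<in>set ?L. if \<not> (beta6_arc d a \<and> beta6_arc d b \<and> beta6_arc d c) then True else
      (\<forall>e\<in>set ?L. if \<not> (beta6_arc e a \<and> beta6_arc e b \<and> beta6_arc e c \<and> beta6_arc e d) then True else
      (\<forall>g\<in>set ?L. \<not> (beta6_arc g d \<and> beta6_arc g e \<and> beta6_arc a g \<and> beta6_arc b g \<and> beta6_arc c g)))))"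
    by code_simp
  have if_eq_imp: "(if \<not> P then True else Q) \<longleftrightarrow> (P \<longrightarrow> Q)" for P Q by simp
  have in_L: "f 0 \<in> set ?L" "f 1 \<in> set ?L" "f 2 \<in> set ?L" "f 3 \<in> set ?L" "f 4 \<in> set ?L" "f 5 \<in> set ?L"
    by (rule in_V, simp add: V_def)+
  have "beta6_arc (f 1) (f 0)" "beta6_arc (f 2) (f 0)" "beta6_arc (f 2) (f 1)"
    "beta6_arc (f 3) (f 0)" "beta6_arc (f 3) (f 1)" "beta6_arc (f 3) (f 2)"
    "beta6_arc (f 4) (f 0)" "beta6_arc (f 4) (f 1)" "beta6_arc (f 4) (f 2)" "beta6_arc (f 4) (f 3)"
    "beta6_arc (f 5) (f 3)" "beta6_arc (f 5) (f 4)"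
    "beta6_arc (f 0) (f 5)" "beta6_arc (f 1) (f 5)" "beta6_arc (f 2) (f 5)"
    by (rule f; simp add: beta6_arc_def V_def)+
  then show False
    using none[unfolded if_eq_imp, rule_format, of "f 0" "f 1" "f 2" "f 3" "f 4" "f 5"] in_L by blast
qed

section \<open>Words without the 6-vertex tournament or its dual\<close>

lemma beta6_words_eq: "beta6_words = [
    [True, True, True, False, True, True],
    [True, True, False, True, True, False],
    [True, False, True, True, False, False],
    [False, True, True, False, False, False],
    [True, True, False, False, False, True],
    [True, False, False, False, True, False],
    [False, False, False, True, False, False],
    [False, False, True, False, False, True],
    [False, True, False, False, True, True],
    [True, False, False, True, True, True],
    [False, False, True, True, True, False],
    [False, True, True, True, False, True],
    [True, True, False, True, True, True],
    [True, False, True, True, True, False],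
    [False, True, True, True, False, False],
    [True, True, True, False, False, True],
    [True, True, False, False, True, False],
    [True, False, False, True, False, False],
    [False, False, True, False, False, False],
    [False, True, False, False, False, True],
    [True, False, False, False, True, True],
    [False, False, False, True, True, False],
    [False, False, True, True, False, True],
    [False, True, True, False, True, True]]"
  by code_simp

definition beta6_free :: "bool list \<Rightarrow> bool" where
  "beta6_free w \<longleftrightarrow> (\<forall>b\<in>set beta6_words. \<not> subseq b w)"

lemmas beta6_free_code [code] = beta6_free_def[unfolded beta6_words_eq]

lemma beta6_free_ConsD: "beta6_free (c # w) \<Longrightarrow> beta6_free w"
  unfolding beta6_free_def by (blast intro: list_emb_Cons)

text \<open>Tails of free words are free, so prefixing letters and filtering at each length loses no
  word and keeps the search small.\<close>

fun beta6_free_words :: "nat \<Rightarrow> bool list list" where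
  "beta6_free_words 0 = [[]]"
| "beta6_free_words (Suc n) =
    filter beta6_free (concat (map (\<lambda>u. [True # u, False # u]) (beta6_free_words n)))"

lemma beta6_free_in_words: "beta6_free w \<Longrightarrow> w \<in> set (beta6_free_words (length w))"
proof (induction w)
  case (Cons c w)
  then show ?case
    using beta6_free_ConsD by (cases c) auto
qed simp

text \<open>Three families that contain all free words of length at least 8, by
  \<open>beta6_free_word_shape\<close>.\<close>

definition word_shape :: "bool list \<Rightarrow> bool" where
  "word_shape w \<longleftrightarrow> (\<exists>s i j. w = replicate i s @ replicate j (\<not> s) \<or>
     w = replicate i s @ [\<not> s, s] @ replicate j (\<not> s) \<or> w = [s] @ replicate j (\<not> s) @ [s])"

text \<open>For large \<open>i\<close>, truncated subtraction lets in words of length other than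
  \<open>n\<close>; they still have a shape, as \<open>word_shapes_sound\<close> asks.\<close>

definition word_shapes :: "nat \<Rightarrow> bool list list" where
  "word_shapes n = concat (map (\<lambda>s. (s # replicate (n - 2) (\<not> s) @ [s]) #
     concat (map (\<lambda>i. [replicate i s @ replicate (n - i) (\<not> s),
       replicate i s @ [\<not> s, s] @ replicate (n - 2 - i) (\<not> s)]) [0..<Suc n])) [True, False])"

lemma word_shapes_sound: "w \<in> set (word_shapes n) \<Longrightarrow> word_shape w"
  unfolding word_shapes_def word_shape_def by fastforce

text \<open>Base of the induction on length. Length 7 would be too short: the alternating word of
  that length is free and has none of the shapes.\<close>

lemma beta6_free_words_8: "\<forall>w\<in>set (beta6_free_words 8). w \<in> set (word_shapes 8)"
  by code_simp

text \<open>Settles the lengths below 8 by evaluation. Length 0 is left out because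
  \<open>neg_rotate\<close> lengthens the empty word.\<close>

lemma beta6_free_words_small_self_dual:
  "\<forall>n\<in>set [1..<8]. \<forall>w\<in>set (beta6_free_words n). rev w \<in> (\<lambda>i. (neg_rotate ^^ i) w) ` set [0..<2 * n]"
  by code_simp

lemma subseq_replicate: "m \<le> n \<Longrightarrow> subseq (replicate m c) (replicate n c)"
proof (induction n)
  case (Suc n)
  then show ?case by (cases "m = Suc n") (auto intro: list_emb_Cons)
qed simp

text \<open>Either the longer word again has a shape, or the length bound yields a run of three
  letters and with it a subsequence from \<open>beta6_words\<close>.\<close>

lemma word_shape_Cons:
  assumes "word_shape u" "8 \<le> length u" "beta6_free (c # u)"
  shows "word_shape (c # u)"
proof -
  have no_subseq: False if "subseq b (c # u)" "b \<in> set beta6_words" for b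
    using assms(3) that unfolding beta6_free_def by blast
  obtain s i j where u: "u = replicate i s @ replicate j (\<not> s) \<or>
     u = replicate i s @ [\<not> s, s] @ replicate j (\<not> s) \<or> u = [s] @ replicate j (\<not> s) @ [s]"
    using assms(1) unfolding word_shape_def by blast
  consider (1) "c = s" "u = replicate i s @ replicate j (\<not> s)"
    | (2) "c = s" "u = replicate i s @ [\<not> s, s] @ replicate j (\<not> s)"
    | (3) "c = s" "u = [s] @ replicate j (\<not> s) @ [s]"
    | (4) "c = (\<not> s)" "u = replicate i s @ replicate j (\<not> s)"
    | (5) "c = (\<not> s)" "u = replicate i s @ [\<not> s, s] @ replicate j (\<not> s)"
    | (6) "c = (\<not> s)" "u = [s] @ replicate j (\<not> s) @ [s]"
    using u by fastforce
  then show ?thesis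
  proof cases
    case 1
    then show ?thesis
      unfolding word_shape_def
      by (intro exI[of _ s] exI[of _ "Suc i"] exI[of _ j]) simp
  next
    case 2
    then show ?thesis
      unfolding word_shape_def
      by (intro exI[of _ s] exI[of _ "Suc i"] exI[of _ j]) simp
  next
    case 3
    then have "3 \<le> j" using assms(2) by simp
    then have "subseq ([s, s] @ replicate 3 (\<not> s) @ [s]) (c # u)"
      unfolding 3 append_Cons append_Nil
      by (intro subseq_Cons2 list_emb_append_mono subseq_replicate) simp_all
    then have False
      by (rule no_subseq) (cases s; simp add: beta6_words_eq numeral_3_eq_3)
    then show ?thesis ..
  next
    case 4
    \<comment> \<open>The first four cases lead to a shape; otherwise both runs have at least two
      letters and one of them at least three.\<close>
    consider "i = 0" | "i = 1" | "j = 0" | "j = 1" | "3 \<le> i" "2 \<le> j" | "2 \<le> i" "3 \<le> j"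
      using assms(2) 4 by fastforce
    then show ?thesis
    proof cases
      case 1
      then show ?thesis
        unfolding word_shape_def 4
        by (intro exI[of _ s] exI[of _ 0] exI[of _ "Suc j"]) simp
    next
      case 2
      then show ?thesis
        unfolding word_shape_def 4
        by (intro exI[of _ s] exI[of _ 0] exI[of _ j]) simp
    next
      case 3
      then show ?thesis
        unfolding word_shape_def 4
        by (intro exI[of _ "\<not> s"] exI[of _ 1] exI[of _ i]) simp
    next
      case 4
      then show ?thesis
        unfolding word_shape_def \<open>c = (\<not> s)\<close> \<open>u = replicate i s @ replicate j (\<not> s)\<close>
        by (intro exI[of _ "\<not> s"] exI[of _ 0] exI[of _ i]) simp
    next
      case 5
      then have "subseq ([\<not> s] @ replicate 3 s @ replicate 2 (\<not> s)) (c # u)"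
        unfolding 4 append_Cons append_Nil
        by (intro subseq_Cons2 list_emb_append_mono subseq_replicate) simp_all
      then have False
        by (rule no_subseq) (cases s; simp add: beta6_words_eq numeral_3_eq_3 numeral_2_eq_2)
      then show ?thesis ..
    next
      case 6
      then have "subseq ([\<not> s] @ replicate 2 s @ replicate 3 (\<not> s)) (c # u)"
        unfolding 4 append_Cons append_Nil
        by (intro subseq_Cons2 list_emb_append_mono subseq_replicate) simp_all
      then have False
        by (rule no_subseq) (cases s; simp add: beta6_words_eq numeral_3_eq_3 numeral_2_eq_2)
      then show ?thesis ..
    qed
  next
    case 5
    consider "3 \<le> i" | "3 \<le> j"
      using assms(2) 5 by fastforce
    then show ?thesis
    proof cases
      case 1
      \<comment> \<open>The empty last block keeps the block pattern of \<open>u\<close>, so that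
        the embedding goes block by block.\<close>
      then have "subseq ([\<not> s] @ replicate 3 s @ [\<not> s, s] @ replicate 0 (\<not> s)) (c # u)"
        unfolding 5 append_Cons append_Nil
        by (intro subseq_Cons2 list_emb_append_mono subseq_replicate) simp_all
      then have False
        by (rule no_subseq) (cases s; simp add: beta6_words_eq numeral_3_eq_3)
      then show ?thesis ..
    next
      case 2
      then have "subseq ([\<not> s] @ replicate 0 s @ [\<not> s, s] @ replicate 3 (\<not> s)) (c # u)"
        unfolding 5 append_Cons append_Nil
        by (intro subseq_Cons2 list_emb_append_mono subseq_replicate) simp_all
      then have False
        by (rule no_subseq) (cases s; simp add: beta6_words_eq numeral_3_eq_3)
      then show ?thesis ..
    qed
  next
    case 6
    then have "3 \<le> j" using assms(2) by simp
    then have "subseq ([\<not> s, s] @ replicate 3 (\<not> s) @ [s]) (c # u)"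
      unfolding 6 append_Cons append_Nil
      by (intro subseq_Cons2 list_emb_append_mono subseq_replicate) simp_all
    then have False
      by (rule no_subseq) (cases s; simp add: beta6_words_eq numeral_3_eq_3)
    then show ?thesis ..
  qed
qed

lemma beta6_free_word_shape:
  assumes "beta6_free w" "8 \<le> length w"
  shows "word_shape w"
  using assms
proof (induction w)
  case (Cons c w)
  show ?case
  proof (cases "8 \<le> length w")
    case True
    then show ?thesis
      using Cons beta6_free_ConsD word_shape_Cons by blast
  next
    case False
    then have "length (c # w) = 8"
      using Cons.prems(2) by simp
    then have "c # w \<in> set (beta6_free_words 8)"
      using beta6_free_in_words[OF Cons.prems(1)] by simp
    then show ?thesis
      using beta6_free_words_8 word_shapes_sound by blast
  qed
qed simp

text \<open>Rotating the first block to the end brings a word of the first two shapes and its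
  reversal to the same word up to negation; the third shape is a palindrome.\<close>

lemma word_shape_iso_rev:
  assumes "word_shape w"
  shows "word_iso w (rev w)"
proof -
  have iso_not: "word_iso v w" if "word_iso v u" "word_iso w (map Not u)" for u v w
    using that word_iso_map_Not word_iso_sym word_iso_trans by blast
  obtain s i j where w: "w = replicate i s @ replicate j (\<not> s) \<or>
     w = replicate i s @ [\<not> s, s] @ replicate j (\<not> s) \<or> w = [s] @ replicate j (\<not> s) @ [s]"
    using assms unfolding word_shape_def by blast
  then consider (1) "w = replicate i s @ replicate j (\<not> s)"
    | (2) "w = replicate i s @ [\<not> s, s] @ replicate j (\<not> s)" | (3) "w = [s] @ replicate j (\<not> s) @ [s]"
    by blast
  then show ?thesis
  proof cases
    case 1
    have "word_iso w (replicate (i + j) (\<not> s))"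
      using word_iso_rotate[of "replicate i s" "replicate j (\<not> s)"] unfolding 1
      by (simp add: replicate_add[symmetric] add.commute)
    moreover have "word_iso (rev w) (map Not (replicate (i + j) (\<not> s)))"
      using word_iso_rotate[of "replicate j (\<not> s)" "replicate i s"] unfolding 1
      by (simp add: replicate_add[symmetric])
    ultimately show ?thesis by (rule iso_not)
  next
    case 2
    have "word_iso w ([\<not> s, s] @ replicate (i + j) (\<not> s))"
      using word_iso_rotate[of "replicate i s" "[\<not> s, s] @ replicate j (\<not> s)"] unfolding 2
      by (simp add: replicate_add[symmetric] add.commute)
    moreover have "word_iso (rev w) (map Not ([\<not> s, s] @ replicate (i + j) (\<not> s)))"
      using word_iso_rotate[of "replicate j (\<not> s)" "[s, \<not> s] @ replicate i s"] unfolding 2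
      by (simp add: replicate_add[symmetric])
    ultimately show ?thesis by (rule iso_not)
  next
    case 3
    then show ?thesis using word_iso_refl by simp
  qed
qed

lemma beta6_free_word_iso_rev:
  assumes "beta6_free w"
  shows "word_iso w (rev w)"
proof (cases "8 \<le> length w")
  case True
  then show ?thesis
    using assms beta6_free_word_shape word_shape_iso_rev by blast
next
  case False
  show ?thesis
  proof (cases "w = []")
    case True
    then show ?thesis using word_iso_refl by simp
  next
    case ne: False
    then have "length w \<in> set [1..<8]"
      using False by (cases w) auto
    then have "rev w \<in> (\<lambda>i. (neg_rotate ^^ i) w) ` set [0..<2 * length w]"
      using beta6_free_words_small_self_dual beta6_free_in_words[OF assms] by blast
    then show ?thesis
      using word_iso_neg_rotate_power[OF ne] by fastforce
  qed
qed

text \<open>Supplies the hypothesis \<open>self_dual\<close> of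
  \<open>rel_iso_of_link_class\<close>. A subsequence from \<open>beta6_words\<close> in the
  associated word would pull back to a forbidden subset of \<open>C\<close>, so the word is free and
  equivalent to its reversal.\<close>

lemma diamond_free_beta6_free_self_dual:
  assumes "finite C" "tournament_on C E"
    and "\<And>a b c d. \<lbrakk>a \<in> C; b \<in> C; c \<in> C; d \<in> C; cycle3 E a b c\<rbrakk> \<Longrightarrow> \<not> (E d a \<and> E d b \<and> E d c)"
    and "\<And>a b c d. \<lbrakk>a \<in> C; b \<in> C; c \<in> C; d \<in> C; cycle3 E a b c\<rbrakk> \<Longrightarrow> \<not> (E a d \<and> E b d \<and> E c d)"
    and "\<And>S. S \<subseteq> C \<Longrightarrow> \<not> rel_iso S E {0, 1, 2, 3, 4, 5} beta6_arc"
    and "\<And>S. S \<subseteq> C \<Longrightarrow> \<not> rel_iso S E {0, 1, 2, 3, 4, 5} beta6_arc\<inverse>\<inverse>"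
  shows "rel_iso C E C E\<inverse>\<inverse>"
proof -
  obtain w where w: "rel_iso C E {..<length w} (word_arc w)"
    using diamond_free_imp_word[of C E] assms(1-4) by blast
  have "beta6_free w"
    unfolding beta6_free_def
  proof (intro ballI notI)
    fix b assume b: "b \<in> set beta6_words" "subseq b w"
    obtain S where "S \<subseteq> {..<length w}" "rel_iso S (word_arc w) {..<length b} (word_arc b)"
      using subseq_imp_word_embedding[OF b(2)] by blast
    moreover obtain S' where S': "S' \<subseteq> C" "rel_iso S' E S (word_arc w)"
      using rel_iso_restrict[OF w calculation(1)] by blast
    ultimately have "rel_iso S' E {..<length b} (word_arc b)"
      using rel_iso_trans by blast
    then show False
      using beta6_word_iso[OF b(1)] rel_iso_trans assms(5,6) S'(1) by blast
  qed
  then have "rel_iso {..<length w} (word_arc w) {..<length w} (word_arc w)\<inverse>\<inverse>"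
    by (intro word_iso_rev_imp_self_dual beta6_free_word_iso_rev)
  then show ?thesis
    using w rel_iso_conversep[OF w] by (meson rel_iso_sym rel_iso_trans)
qed

section \<open>Reconstruction from 6-element subsets\<close>

lemma iso_imp_cycle3_preserved:
  assumes "tournament_on {a, b, c} F" "rel_iso {a, b, c} E {a, b, c} F" "cycle3 E a b c"
  shows "cycle3 F a b c \<or> cycle3 F c b a"
proof -
  obtain f where f: "bij_betw f {a, b, c} {a, b, c}"
      "\<forall>x\<in>{a, b, c}. \<forall>y\<in>{a, b, c}. E x y \<longleftrightarrow> F (f x) (f y)"
    using assms(2) unfolding rel_iso_def by blast
  have "F (f a) (f b)" "F (f b) (f c)" "F (f c) (f a)"
    using f(2) assms(3) unfolding cycle3_def by auto
  moreover have "f a \<in> {a, b, c}" "f b \<in> {a, b, c}" "f c \<in> {a, b, c}"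
    using bij_betwE[OF f(1)] by blast+
  moreover have "\<not> F a a" "\<not> F b b" "\<not> F c c"
    using tournament_onD[OF assms(1)] by blast+
  moreover have "\<not> (F a b \<and> F b a)" "\<not> (F b c \<and> F c b)" "\<not> (F c a \<and> F a c)"
    using tournament_onD[OF assms(1), of a b] tournament_onD[OF assms(1), of b c]
      tournament_onD[OF assms(1), of c a] by blast+
  ultimately show ?thesis
    unfolding cycle3_def insert_iff empty_iff by (elim disjE) simp_all
qed

text \<open>The image of \<open>d\<close> has no in-neighbour, whereas every vertex of the 3-cycle
  has one; so the isomorphism fixes \<open>d\<close>.\<close>

lemma iso_imp_source_preserved:
  assumes "tournament_on {a, b, c, d} F" "rel_iso {a, b, c, d} E {a, b, c, d} F"
    and "cycle3 F a b c \<or> cycle3 F c b a" "E d a" "E d b" "E d c" "\<not> E d d"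
  shows "F d a"
proof -
  let ?V = "{a, b, c, d}"
  obtain f where f: "bij_betw f ?V ?V" "\<forall>x\<in>?V. \<forall>y\<in>?V. E x y \<longleftrightarrow> F (f x) (f y)"
    using assms(2) unfolding rel_iso_def by blast
  have "F (f d) y" if "y \<in> ?V" "y \<noteq> f d" for y
  proof -
    obtain x where x: "x \<in> ?V" "y = f x"
      using bij_betw_imp_surj_on[OF f(1)] \<open>y \<in> ?V\<close> by (metis imageE)
    then have "E d x" using assms(4-6) that by blast
    then show ?thesis using f(2) x by blast
  qed
  note dom = this
  have "f d \<in> ?V" using bij_betwE[OF f(1)] by blast
  moreover have no_pred: "\<not> F y (f d)" if "y \<in> ?V" for y
    using tournament_onD[OF assms(1) that \<open>f d \<in> ?V\<close>] dom[OF that] by blast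
  moreover have "f d \<noteq> a" "f d \<noteq> b" "f d \<noteq> c"
    using no_pred[of a] no_pred[of b] no_pred[of c] assms(3) unfolding cycle3_def by auto
  ultimately have "f d = d" by blast
  then show ?thesis
    using dom[of a] \<open>f d \<noteq> a\<close> by auto
qed

lemma hypomorphic_imp_tournament_pair:
  assumes "finite V" and E: "tournament_on V E" and F: "tournament_on V F"
    and iso: "\<And>K. K \<subseteq> V \<Longrightarrow> card K \<le> 4 \<Longrightarrow> rel_iso K E K F"
  shows "tournament_pair V E F"
proof
  show "finite V" "tournament_on V E" "tournament_on V F" by fact+
  fix a b c assume abc: "a \<in> V" "b \<in> V" "c \<in> V"
  then have V3: "{a, b, c} \<subseteq> V" by blast
  have iso3: "rel_iso {a, b, c} E {a, b, c} F"
    using abc by (intro iso) (auto simp: card_insert_if)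
  show EF: "cycle3 F a b c \<or> cycle3 F c b a" if "cycle3 E a b c"
    using iso_imp_cycle3_preserved[OF tournament_on_subset[OF F V3] iso3 that] .
  show "cycle3 E a b c \<or> cycle3 E c b a" if "cycle3 F a b c"
    using iso_imp_cycle3_preserved[OF tournament_on_subset[OF E V3] rel_iso_sym[OF iso3] that] .
  fix d assume d: "d \<in> V"
  then have V4: "{a, b, c, d} \<subseteq> V" using abc by blast
  have "card {a, b, c, d} \<le> 4"
    by (simp add: card_insert_if)
  then have iso4: "rel_iso {a, b, c, d} E {a, b, c, d} F"
    using V4 iso by blast
  have "\<not> E d d" using tournament_onD[OF E d d] by blast
  show "F d a" if "cycle3 E a b c" "E d a" "E d b" "E d c"
    using iso_imp_source_preserved[OF tournament_on_subset[OF F V4] iso4 EF[OF that(1)] that(2-4)]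
      \<open>\<not> E d d\<close> by blast
  \<comment> \<open>The sink condition is the source condition for the converses.\<close>
  show "F a d" if "cycle3 E a b c" "E a d" "E b d" "E c d"
    using iso_imp_source_preserved[OF tournament_on_conversep[OF tournament_on_subset[OF F V4]]
        rel_iso_conversep[OF iso4]] EF[OF that(1)] that(2-4) \<open>\<not> E d d\<close>
    unfolding cycle3_conversep conversep_iff by blast
qed

lemma (in tournament_pair) same_beta6_imp_iso:
  assumes "\<And>S. S \<subseteq> V \<Longrightarrow> card S = 6 \<Longrightarrow>
    rel_iso S E {0, 1, 2, 3, 4, 5} beta6_arc \<longleftrightarrow> rel_iso S F {0, 1, 2, 3, 4, 5} beta6_arc"
  shows "rel_iso V E V F"
proof (rule rel_iso_glue)
  fix x assume x: "x \<in> V"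
  show "rel_iso {y. reversed\<^sup>*\<^sup>* x y} E {y. reversed\<^sup>*\<^sup>* x y} F"
  proof (rule rel_iso_of_link_class[of "{0, 1, 2, 3, 4, 5}" beta6_arc])
    fix C assume "C \<subseteq> V"
    then have "finite C" "tournament_on C E"
      using finite_V tournament_E finite_subset tournament_on_subset by blast+
    then show "rel_iso C E C E\<inverse>\<inverse>" if
      "\<And>a b c d. \<lbrakk>a \<in> C; b \<in> C; c \<in> C; d \<in> C; cycle3 E a b c\<rbrakk> \<Longrightarrow> \<not> (E d a \<and> E d b \<and> E d c)"
      "\<And>a b c d. \<lbrakk>a \<in> C; b \<in> C; c \<in> C; d \<in> C; cycle3 E a b c\<rbrakk> \<Longrightarrow> \<not> (E a d \<and> E b d \<and> E c d)"
      "\<And>S. S \<subseteq> C \<Longrightarrow> \<not> rel_iso S E {0, 1, 2, 3, 4, 5} beta6_arc"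
      "\<And>S. S \<subseteq> C \<Longrightarrow> \<not> rel_iso S E {0, 1, 2, 3, 4, 5} beta6_arc\<inverse>\<inverse>"
      using that by (rule diamond_free_beta6_free_self_dual)
  qed (use assms beta6_arc_not_self_dual x in simp_all)
qed

lemma beta6_arc_diamond_free:
  assumes "a \<in> {0, 1, 2, 3, 4, 5}" "b \<in> {0, 1, 2, 3, 4, 5}" "c \<in> {0, 1, 2, 3, 4, 5}"
    "d \<in> {0, 1, 2, 3, 4, 5}" "cycle3 beta6_arc a b c"
  shows "\<not> (beta6_arc d a \<and> beta6_arc d b \<and> beta6_arc d c)"
    and "\<not> (beta6_arc a d \<and> beta6_arc b d \<and> beta6_arc c d)"
proof -
  let ?L = "[0, 1, 2, 3, 4, 5] :: nat list"
  have *: "\<forall>a\<in>set ?L. \<forall>b\<in>set ?L. if \<not> beta6_arc a b then True else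
      (\<forall>c\<in>set ?L. if \<not> (beta6_arc b c \<and> beta6_arc c a) then True else
      (\<forall>d\<in>set ?L. \<not> (beta6_arc d a \<and> beta6_arc d b \<and> beta6_arc d c) \<and>
        \<not> (beta6_arc a d \<and> beta6_arc b d \<and> beta6_arc c d)))"
    by code_simp
  have if_eq_imp: "(if \<not> P then True else Q) \<longleftrightarrow> (P \<longrightarrow> Q)" for P Q by simp
  have "a \<in> set ?L" "b \<in> set ?L" "c \<in> set ?L" "d \<in> set ?L"
    using assms(1-4) by simp_all
  then have "\<not> (beta6_arc d a \<and> beta6_arc d b \<and> beta6_arc d c) \<and>
      \<not> (beta6_arc a d \<and> beta6_arc b d \<and> beta6_arc c d)"
    using *[unfolded if_eq_imp, rule_format, of a b c d] assms(5) unfolding cycle3_def by blast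
  then show "\<not> (beta6_arc d a \<and> beta6_arc d b \<and> beta6_arc d c)"
    and "\<not> (beta6_arc a d \<and> beta6_arc b d \<and> beta6_arc c d)" by blast+
qed

text \<open>
  Some vertex \<open>x\<close> is the source or the sink of a 7-element set \<open>insert x S\<close>; a 3-cycle inside \<open>S\<close>
  gives a diamond, which lies in a 6-element subset.
\<close>
lemma not_all_six_subsets_beta6:
  assumes "finite V" "tournament_on V E" "12 \<le> card V"
  shows "\<exists>S\<subseteq>V. card S = 6 \<and> \<not> rel_iso S E {0, 1, 2, 3, 4, 5} beta6_arc"
proof (rule ccontr)
  let ?U = "{0, 1, 2, 3, 4, 5} :: nat set"
  assume "\<not> ?thesis"
  then have all: "rel_iso S E ?U beta6_arc" if "S \<subseteq> V" "card S = 6" for S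
    using that by blast
  obtain x where x: "x \<in> V"
    using assms(3) by fastforce
  let ?O = "{y \<in> V. E x y}" and ?I = "{y \<in> V. E y x}"
  have "V - {x} \<subseteq> ?O \<union> ?I"
    using tournament_onD[OF assms(2) x] by blast
  \<comment> \<open>At least eleven vertices remain besides \<open>x\<close>, so one of the two
    neighbourhoods has at least six.\<close>
  then have "card (V - {x}) \<le> card (?O \<union> ?I)"
    using assms(1) by (intro card_mono) auto
  also have "\<dots> \<le> card ?O + card ?I"
    by (rule card_Un_le)
  finally have "6 \<le> card ?O \<or> 6 \<le> card ?I"
    using assms(1,3) x by auto
  then obtain S where S: "S \<subseteq> V" "card S = 6" "(\<forall>y\<in>S. E x y) \<or> (\<forall>y\<in>S. E y x)"
    by (elim disjE; elim obtain_subset_with_card_n) blast+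
  have finS: "finite S" using S(1) assms(1) finite_subset by blast
  have "x \<notin> S"
    using S(3) tournament_onD[OF assms(2) x x] by blast
  obtain f where f: "bij_betw f ?U S" "\<forall>i\<in>?U. \<forall>j\<in>?U. beta6_arc i j \<longleftrightarrow> E (f i) (f j)"
    using rel_iso_sym[OF all[OF S(1,2)]] unfolding rel_iso_def by blast
  have fS: "f i \<in> S" if "i \<in> ?U" for i
    using bij_betwE[OF f(1)] that by blast
  have cyc: "cycle3 E (f 0) (f 3) (f 5)"
    using f(2) unfolding cycle3_def beta6_arc_def by auto
  have f_ne: "f i \<noteq> f 1" if "i \<in> ?U" "i \<noteq> 1" for i
    using bij_betw_imp_inj_on[OF f(1)] that unfolding inj_on_def by auto
  \<comment> \<open>Vertex 1 is off the 3-cycle 0, 3, 5; trading \<open>f 1\<close> for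
    \<open>x\<close> leaves a 6-set that contains the cycle together with its source or sink
    \<open>x\<close>.\<close>
  let ?K = "insert x (S - {f 1})"
  have "?K \<subseteq> V" using S(1) x by blast
  moreover have "card ?K = 6"
    using finS S(2) \<open>x \<notin> S\<close> fS[of 1] by simp
  ultimately obtain h where h: "bij_betw h ?K ?U" "\<forall>i\<in>?K. \<forall>j\<in>?K. E i j \<longleftrightarrow> beta6_arc (h i) (h j)"
    using all unfolding rel_iso_def by blast
  have K: "x \<in> ?K" "f 0 \<in> ?K" "f 3 \<in> ?K" "f 5 \<in> ?K"
    using fS f_ne by auto
  have hU: "h i \<in> ?U" if "i \<in> ?K" for i
    using bij_betwE[OF h(1)] that by (rule bspec)
  have hcyc: "cycle3 beta6_arc (h (f 0)) (h (f 3)) (h (f 5))"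
    using h(2) K cyc unfolding cycle3_def by blast
  note diamond = beta6_arc_diamond_free[OF hU hU hU hU hcyc, OF K(2,3,4,1)]
  from S(3) show False
  proof
    assume "\<forall>y\<in>S. E x y"
    then have "E x (f 0)" "E x (f 3)" "E x (f 5)" using fS by auto
    then show False using diamond(1) h(2) K by blast
  next
    assume "\<forall>y\<in>S. E y x"
    then have "E (f 0) x" "E (f 3) x" "E (f 5) x" using fS by auto
    then show False using diamond(2) h(2) K by blast
  qed
qed

section \<open>Binomial coefficients under the digit conditions\<close>

lemma not_dvd_choose_shift:
  fixes p :: nat
  assumes "prime p" "k = q + r * p ^ e" "i \<le> q" "t - i < p ^ e" "\<not> p dvd (q - i choose (t - i))"
  shows "\<not> p dvd (k - i choose (t - i))"
proof -
  \<comment> \<open>The condition \<open>i \<le> q\<close> keeps this subtraction exact; it is why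
    the residues chosen for \<open>k\<close> below are not reduced to 0.\<close>
  have "k - i = (q - i) + r * p ^ e" using assms(2,3) by simp
  then have "[(k - i) choose (t - i) = (q - i) choose (t - i)] (mod p)"
    using choose_add_mult_prime_power_cong[OF assms(1,4)] by simp
  then show ?thesis
    using assms(5) cong_dvd_iff by blast
qed

lemma beta6_arc_eq: "beta6_arc x y \<longleftrightarrow> (x, y) \<in> arcs_ends beta6_plus"
  unfolding beta6_arc_def beta6_plus_def by simp

lemma base_expansion_low_digits:
  assumes "base_expansion p k m d"
  obtains r where "k = d 0 + d 1 * p + d 2 * p ^ 2 + r * p ^ 3"
proof -
  have k: "k = (\<Sum>i\<le>m. d i * p ^ i)" and zero: "\<And>i. m < i \<Longrightarrow> d i = 0"
    using assms unfolding base_expansion_def by auto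
  \<comment> \<open>Padding with zero digits makes the three lowest digits explicit whatever
    \<open>m\<close> is.\<close>
  have "k = (\<Sum>i\<le>m + 3. d i * p ^ i)"
    unfolding k using zero by (intro sum.mono_neutral_left) (auto simp: not_le[symmetric])
  also have "\<dots> = d 0 + d 1 * p + d 2 * p ^ 2 + (\<Sum>i\<le>m. d (Suc (Suc (Suc i))) * p ^ i) * p ^ 3"
    by (simp add: numeral_3_eq_3 numeral_2_eq_2 sum.atMost_Suc_shift sum_distrib_left
        algebra_simps del: sum.atMost_Suc)
  finally show ?thesis by (rule that)
qed

text \<open>In the six cases \<open>k\<close> is replaced by \<open>q\<close> equal to
  \<open>d 0\<close>, \<open>p\<close>, 6, 6, 9 and 6, congruent to it modulo a power of
  \<open>p\<close>. The last conjunct adds index 0 for \<open>p = 2\<close>, where constancy modulo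
  \<open>p\<close> cannot tell -1 from 1.\<close>

lemma digit_conditions_not_dvd:
  fixes p k :: nat
  assumes "prime p" "base_expansion p k m d" "6 \<le> k"
    and "(p \<ge> 7 \<and> (d 0 \<ge> 6 \<or> d 0 = 0)) \<or> (p = 5 \<and> d 0 = 1 \<and> d 1 \<noteq> 0) \<or>
      (p = 3 \<and> d 0 = 0 \<and> d 1 = 2) \<or> (p = 3 \<and> d 0 = 0 \<and> d 1 = 0) \<or>
      (p = 2 \<and> d 0 = 0 \<and> d 1 = 1 \<and> d 2 = 1)"
  shows "(\<forall>i\<in>{1..6}. \<not> p dvd (k - i choose (6 - i))) \<and> (3 \<le> p \<or> \<not> p dvd (k choose 6))"
proof -
  obtain r where k: "k = d 0 + d 1 * p + d 2 * p ^ 2 + r * p ^ 3"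
    using base_expansion_low_digits[OF assms(2)] .
  have lt: "d i < p" for i
    using assms(2) unfolding base_expansion_def by blast
  note shift = not_dvd_choose_shift[OF assms(1), of k _ _ _ _ 6]
  consider (1) "p \<ge> 7" "d 0 \<ge> 6" | (2) "p \<ge> 7" "d 0 = 0" | (3) "p = 5" "d 0 = 1" "d 1 \<noteq> 0"
    | (4) "p = 3" "d 0 = 0" "d 1 = 2" | (5) "p = 3" "d 0 = 0" "d 1 = 0"
    | (6) "p = 2" "d 0 = 0" "d 1 = 1" "d 2 = 1"
    using assms(4) by (elim disjE conjE) simp_all
  then show ?thesis
  proof cases
    case 1
    have k': "k = d 0 + (d 1 + d 2 * p + r * p ^ 2) * p ^ 1"
      unfolding k by (simp add: power2_eq_square power3_eq_cube algebra_simps)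
    have "\<not> p dvd (k - i choose (6 - i))" if "i \<in> {1..6}" for i
      using 1 lt[of 0] that by (intro shift[OF k'] prime_not_dvd_choose assms(1)) auto
    then show ?thesis using 1 by simp
  next
    case 2
    have k': "k = (d 1 + d 2 * p + r * p ^ 2) * p"
      unfolding k using 2 by (simp add: power2_eq_square power3_eq_cube algebra_simps)
    then obtain s where "d 1 + d 2 * p + r * p ^ 2 = Suc s"
      using assms(3) by (cases "d 1 + d 2 * p + r * p ^ 2") auto
    then have k'': "k = p + s * p ^ 1"
      unfolding k' by simp
    have "\<not> p dvd (k - i choose (6 - i))" if "i \<in> {1..6}" for i
      using 2 that by (intro shift[OF k''] prime_not_dvd_choose assms(1)) auto
    then show ?thesis using 2 by simp
  next
    case 3
    define n where "n = d 1 + (d 2 + r * 5) * 5"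
    have k': "k = 1 + 5 * n"
      unfolding k n_def using 3 by simp
    then obtain s where "n = Suc s"
      using assms(3) by (cases n) auto
    then have k'': "k = 6 + s * p ^ 1"
      unfolding k' using 3 by simp
    have ge_2: "\<not> p dvd (k - i choose (6 - i))" if "i \<in> {2..6}" for i
      using 3 that by (intro shift[OF k'']) auto
    \<comment> \<open>For \<open>i = 1\<close> the lower index 5 is not below \<open>p\<close>, so
      the shift by multiples of 5 fails. Absorption reduces it to \<open>i = 2\<close> and the
      factor \<open>n\<close>, which is congruent to \<open>d 1\<close> modulo 5.\<close>
    have "5 * (k - 1 choose 5) = (k - 1) * (k - 2 choose 4)"
      by (simp add: times_binomial_minus1_eq numeral_2_eq_2)
    then have "k - 1 choose 5 = n * (k - 2 choose 4)"
      unfolding k' by simp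
    moreover have "\<not> p dvd n"
      unfolding n_def using 3 lt[of 1] by (simp add: dvd_add_left_iff) (auto dest: dvd_imp_le)
    ultimately have "\<not> p dvd (k - 1 choose 5)"
      using ge_2[of 2] assms(1) by (simp add: prime_dvd_mult_iff)
    moreover have "i \<in> {1..6} \<longleftrightarrow> i = 1 \<or> i \<in> {2..6}" for i :: nat
      by auto
    ultimately show ?thesis using 3 ge_2 by auto
  next
    case 4
    have k': "k = 6 + (d 2 + r * 3) * p ^ 2"
      unfolding k using 4 by simp
    have "\<not> p dvd (k - i choose (6 - i))" if "i \<in> {1..6}" for i
      using 4 that by (intro shift[OF k']) auto
    then show ?thesis using 4 by simp
  next
    case 5
    have k': "k = (d 2 + r * 3) * 9"
      unfolding k using 5 by simp
    then obtain s where "d 2 + r * 3 = Suc s"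
      using assms(3) by (cases "d 2 + r * 3") auto
    then have k'': "k = 9 + s * p ^ 2"
      unfolding k' using 5 by simp
    have *: "\<forall>i\<in>set [1..<7]. \<not> (3::nat) dvd (9 - i choose (6 - i))"
      by code_simp
    have "\<not> p dvd (k - i choose (6 - i))" if "i \<in> {1..6}" for i
    proof (rule shift[OF k''])
      show "\<not> p dvd (9 - i choose (6 - i))"
        using *[rule_format, of i] 5 that by simp
    qed (use 5 that in auto)
    then show ?thesis using 5 by simp
  next
    case 6
    \<comment> \<open>As \<open>p ^ 3 = 8\<close> exceeds 6, the shift covers index 0 too.\<close>
    have k': "k = 6 + r * p ^ 3"
      unfolding k using 6 by simp
    have "\<not> p dvd (k - i choose (6 - i))" if "i \<le> 6" for i
      using 6(1) that by (intro shift[OF k']) auto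
    from this[of 0] this show ?thesis
      using 6(1) by auto
  qed
qed

section \<open>Digraph isomorphism in terms of arc relations\<close>

lemma arcs_ends_induce:
  "(x, y) \<in> arcs_ends (G \<restriction> S) \<longleftrightarrow> x \<in> S \<and> y \<in> S \<and> (x, y) \<in> arcs_ends G"
  unfolding arcs_ends_def arc_to_ends_def induce_subgraph_def by auto

lemma induce_induce: "S \<subseteq> K \<Longrightarrow> (G \<restriction> K) \<restriction> S = G \<restriction> S"
  unfolding induce_subgraph_def by auto

lemma (in digraph) digraph_induce: "S \<subseteq> verts G \<Longrightarrow> digraph (G \<restriction> S)"
  by (rule digraphI_induced[OF induced_induce])

text \<open>Without parallel arcs, a vertex bijection that respects adjacency determines the
  bijection of arcs, even between different arc types.\<close>

lemma digraph_iso_iff_rel_iso: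
  assumes "digraph G" "digraph H"
  shows "digraph_iso G H \<longleftrightarrow>
    rel_iso (verts G) (\<lambda>x y. (x, y) \<in> arcs_ends G) (verts H) (\<lambda>x y. (x, y) \<in> arcs_ends H)"
    (is "_ \<longleftrightarrow> rel_iso _ ?E _ ?F")
proof
  interpret G: digraph G by fact
  interpret H: digraph H by fact
  show "rel_iso (verts G) ?E (verts H) ?F" if iso: "digraph_iso G H"
  proof -
    obtain h where h: "pre_digraph.digraph_isomorphism G h" and H: "H = app_iso h G"
      using iso unfolding digraph_iso_def by blast
    let ?f = "iso_verts h"
    have "bij_betw ?f (verts G) (verts H)"
      using h unfolding H pre_digraph.digraph_isomorphism_def by (auto simp: bij_betw_def)
    moreover have "?E x y \<longleftrightarrow> ?F (?f x) (?f y)" if "x \<in> verts G" "y \<in> verts G" for x y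
    proof
      assume "?E x y"
      then obtain e where "e \<in> arcs G" "tail G e = x" "head G e = y"
        unfolding arcs_ends_def arc_to_ends_def by auto
      then show "?F (?f x) (?f y)"
        using h unfolding H pre_digraph.digraph_isomorphism_def arcs_ends_def arc_to_ends_def
        by force
    next
      assume "?F (?f x) (?f y)"
      then obtain e where e: "e \<in> arcs G" "?f (tail G e) = ?f x" "?f (head G e) = ?f y"
        using h unfolding H pre_digraph.digraph_isomorphism_def arcs_ends_def arc_to_ends_def
        by force
      then have "tail G e = x" "head G e = y"
        using h that G.wellformed[OF e(1)] unfolding pre_digraph.digraph_isomorphism_def
        by (meson inj_onD)+
      then show "?E x y"
        using e(1) unfolding arcs_ends_def arc_to_ends_def by force
    qed
    ultimately show ?thesis
      unfolding rel_iso_def by blast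
  qed
  show "digraph_iso G H" if iso: "rel_iso (verts G) ?E (verts H) ?F"
  proof -
    obtain f where f: "bij_betw f (verts G) (verts H)"
        "\<forall>x\<in>verts G. \<forall>y\<in>verts G. ?E x y \<longleftrightarrow> ?F (f x) (f y)"
      using iso unfolding rel_iso_def by blast
    have "\<exists>e'. e' \<in> arcs H \<and> tail H e' = f (tail G e) \<and> head H e' = f (head G e)" if "e \<in> arcs G" for e
    proof -
      have "?E (tail G e) (head G e)"
        using that unfolding arcs_ends_def arc_to_ends_def by force
      then have "?F (f (tail G e)) (f (head G e))"
        using f(2) G.wellformed[OF that] by blast
      then show ?thesis
        unfolding arcs_ends_def arc_to_ends_def by auto
    qed
    then obtain g where g: "\<And>e. e \<in> arcs G \<Longrightarrow> g e \<in> arcs H"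
        "\<And>e. e \<in> arcs G \<Longrightarrow> tail H (g e) = f (tail G e)" "\<And>e. e \<in> arcs G \<Longrightarrow> head H (g e) = f (head G e)"
      by metis
    have inj: "inj_on f (verts G)" and surj: "f ` verts G = verts H"
      using f(1) unfolding bij_betw_def by auto
    have "inj_on g (arcs G)"
    proof (rule inj_onI)
      fix e e' assume e: "e \<in> arcs G" "e' \<in> arcs G" "g e = g e'"
      then have "f (tail G e) = f (tail G e')" "f (head G e) = f (head G e')"
        using g by metis+
      then have "arc_to_ends G e = arc_to_ends G e'"
        using inj e G.wellformed unfolding arc_to_ends_def inj_on_def by auto
      then show "e = e'" using e G.no_multi_arcs by blast
    qed
    moreover have "g ` arcs G = arcs H"
    proof (intro equalityI subsetI)
      fix e' assume e': "e' \<in> arcs H"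
      then obtain x y where xy: "x \<in> verts G" "y \<in> verts G" "tail H e' = f x" "head H e' = f y"
        using H.wellformed[OF e'] surj by (metis imageE)
      then have "?F (f x) (f y)"
        using e' unfolding arcs_ends_def arc_to_ends_def by force
      then have "?E x y" using f(2) xy by blast
      then obtain e where e: "e \<in> arcs G" "tail G e = x" "head G e = y"
        unfolding arcs_ends_def arc_to_ends_def by auto
      then have "arc_to_ends H (g e) = arc_to_ends H e'"
        using g xy unfolding arc_to_ends_def by auto
      then have "g e = e'" using e e' g(1) H.no_multi_arcs by blast
      then show "e' \<in> g ` arcs G" using e by blast
    qed (use g in auto)
    ultimately show ?thesis
      unfolding digraph_iso_def pre_digraph.digraph_isomorphism_def app_iso_def
      using inj surj g G.wf_digraph_axioms
      by (intro exI[of _ "\<lparr>iso_verts = f, iso_arcs = g, iso_head = head H, iso_tail = tail H\<rparr>"]) auto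
  qed
qed

lemma digraph_iso_induce_iff:
  assumes "digraph G" "digraph H" "S \<subseteq> verts G" "S' \<subseteq> verts H"
  shows "digraph_iso (G \<restriction> S) (H \<restriction> S') \<longleftrightarrow>
    rel_iso S (\<lambda>x y. (x, y) \<in> arcs_ends G) S' (\<lambda>x y. (x, y) \<in> arcs_ends H)"
proof -
  have "rel_iso S (\<lambda>x y. (x, y) \<in> arcs_ends (G \<restriction> S)) S' (\<lambda>x y. (x, y) \<in> arcs_ends (H \<restriction> S')) \<longleftrightarrow>
    rel_iso S (\<lambda>x y. (x, y) \<in> arcs_ends G) S' (\<lambda>x y. (x, y) \<in> arcs_ends H)"
    unfolding rel_iso_def arcs_ends_induce
    by (rule ex_cong1, rule conj_cong[OF refl]) (auto dest!: bij_betwE)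
  then show ?thesis
    using digraph_iso_iff_rel_iso[OF digraph.digraph_induce[OF assms(1,3)]
        digraph.digraph_induce[OF assms(2,4)]] by simp
qed

lemma (in tournament) tournament_on_arcs_ends:
  "tournament_on (verts G) (\<lambda>x y. (x, y) \<in> arcs_ends G)"
  unfolding tournament_on_def using exactly_one_arc adj_not_same by blast

lemma digraph_iso_beta6_iff:
  assumes "digraph G" "S \<subseteq> verts G"
  shows "digraph_iso (G \<restriction> S) beta6_plus \<longleftrightarrow>
    rel_iso S (\<lambda>x y. (x, y) \<in> arcs_ends G) {0, 1, 2, 3, 4, 5} beta6_arc"
proof -
  interpret beta: tournament beta6_plus by (rule tournament_beta6_plus)
  have v: "verts beta6_plus = {0, 1, 2, 3, 4, 5}"
    by (simp add: beta6_plus_def)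
  \<comment> \<open>Viewing \<open>beta6_plus\<close> as induced on all its vertices makes
    \<open>digraph_iso_induce_iff\<close> applicable.\<close>
  have "beta6_plus \<restriction> {0, 1, 2, 3, 4, 5} = beta6_plus"
    using beta.wellformed unfolding v[symmetric] induce_subgraph_def by (intro pre_digraph.equality) auto
  then show ?thesis
    using digraph_iso_induce_iff[OF assms(1) beta.digraph_axioms assms(2), of "{0, 1, 2, 3, 4, 5}"]
    unfolding v beta6_arc_eq[abs_def] by simp
qed

lemma b6_plus_induce:
  assumes "digraph G" "K \<subseteq> verts G"
  shows "b6_plus (G \<restriction> K) = card {S. S \<subseteq> K \<and> card S = 6 \<and>
    rel_iso S (\<lambda>x y. (x, y) \<in> arcs_ends G) {0, 1, 2, 3, 4, 5} beta6_arc}"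
  unfolding b6_plus_def
  using digraph_iso_beta6_iff[OF assms(1) subset_trans[OF _ assms(2)]]
  by (auto intro!: arg_cong[of _ _ card] simp: induce_induce)

text \<open>Expresses a difference of two counts as the sum of one signed function, the form that
  \<open>inclusion_kernel\<close> treats.\<close>

lemma sum_of_bool_diff_eq:
  assumes "finite K"
  shows "(\<Sum>S | S \<subseteq> K \<and> card S = t. of_bool (P S) - of_bool (Q S)) =
    int (card {S. S \<subseteq> K \<and> card S = t \<and> P S}) - int (card {S. S \<subseteq> K \<and> card S = t \<and> Q S})"
proof -
  have "{S. S \<subseteq> K \<and> card S = t} \<inter> {S. R S} = {S. S \<subseteq> K \<and> card S = t \<and> R S}" for R
    by blast
  then show ?thesis
    using assms by (simp add: sum_subtractf sum_of_bool_eq)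
qed

theorem theorem5p7:
  fixes T :: "('a, 'b) pre_digraph" and T' :: "('a, 'c) pre_digraph"
    and V :: "'a set" and v p k m :: nat and d :: "nat \<Rightarrow> nat"
  assumes "tournament T" and "tournament T'"
    and "verts T = V" and "verts T' = V" and "card V = v"
    and "le_hypomorphic 4 T T'"
    and "prime p"
    and "base_expansion p k m d"
    and "6 \<le> k" and "k + 6 \<le> v"
  shows
    "((\<forall>K. K \<subseteq> V \<and> card K = k \<longrightarrow> b6_plus (T \<restriction> K) = b6_plus (T' \<restriction> K))
        \<longrightarrow> hereditarily_isomorphic T' T)
     \<and>
     ((\<forall>K. K \<subseteq> V \<and> card K = k \<longrightarrow> [b6_plus (T \<restriction> K) = b6_plus (T' \<restriction> K)] (mod p))
        \<longrightarrow>
          (p \<ge> 7 \<and> (d 0 \<ge> 6 \<or> d 0 = 0) \<longrightarrow> hereditarily_isomorphic T' T)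
          \<and>
          ((p = 5 \<and> d 0 = 1 \<and> d 1 \<noteq> 0) \<or>
           (p = 3 \<and> d 0 = 0 \<and> d 1 = 2) \<or>
           (p = 3 \<and> d 0 = 0 \<and> d 1 = 0) \<or>
           (p = 2 \<and> d 0 = 0 \<and> d 1 = 1 \<and> d 2 = 1)
             \<longrightarrow> hereditarily_isomorphic T' T))"
proof -
  interpret T: tournament T by fact
  interpret T': tournament T' by fact
  define E where "E = (\<lambda>x y. (x, y) \<in> arcs_ends T)"
  define F where "F = (\<lambda>x y. (x, y) \<in> arcs_ends T')"
  define P where "P S = rel_iso S E {0, 1, 2, 3, 4, 5} beta6_arc" for S
  define Q where "Q S = rel_iso S F {0, 1, 2, 3, 4, 5} beta6_arc" for S
  define f :: "'a set \<Rightarrow> int" where "f S = of_bool (P S) - of_bool (Q S)" for S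
  have finV: "finite V" using T.finite_verts assms(3) by simp
  have tour_E: "tournament_on V E" and tour_F: "tournament_on V F"
    using T.tournament_on_arcs_ends T'.tournament_on_arcs_ends assms(3,4) unfolding E_def F_def by simp_all
  have iso_iff: "digraph_iso (T \<restriction> X) (T' \<restriction> X) \<longleftrightarrow> rel_iso X E X F"
      "digraph_iso (T' \<restriction> X) (T \<restriction> X) \<longleftrightarrow> rel_iso X F X E" if "X \<subseteq> V" for X
    using digraph_iso_induce_iff T.digraph_axioms T'.digraph_axioms assms(3,4) that
    unfolding E_def F_def by blast+
  have pair: "tournament_pair V E F"
  proof (rule hypomorphic_imp_tournament_pair[OF finV tour_E tour_F])
    fix K assume K: "K \<subseteq> V" "card K \<le> 4"
    then have "hypomorphic (card K) T T'"
      using assms(6) unfolding le_hypomorphic_def by blast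
    then have "digraph_iso (T \<restriction> K) (T' \<restriction> K)"
      using K(1) finite_subset[OF K(1) finV] assms(3) unfolding hypomorphic_def by blast
    then show "rel_iso K E K F" using iso_iff K(1) by blast
  qed
  have hereditary: "hereditarily_isomorphic T' T" if same: "\<And>S. S \<subseteq> V \<Longrightarrow> card S = 6 \<Longrightarrow> f S = 0"
  proof -
    have PQ: "P S \<longleftrightarrow> Q S" if "S \<subseteq> V" "card S = 6" for S
      using same[OF that] unfolding f_def by (auto split: if_splits simp: of_bool_def)
    have "rel_iso X F X E" if X: "X \<subseteq> V" for X
    proof (rule rel_iso_sym)
      \<comment> \<open>The pair and the agreement on 6-sets both restrict to
        \<open>X\<close>.\<close>
      show "rel_iso X E X F"
        using tournament_pair.same_beta6_imp_iso[OF tournament_pair.tournament_pair_subset[OF pair X]]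
          PQ X unfolding P_def Q_def by (meson subset_trans)
    qed
    then show ?thesis
      unfolding hereditarily_isomorphic_def assms(3,4) using iso_iff by blast
  qed
  have sum_f: "(\<Sum>S | S \<subseteq> K \<and> card S = 6. f S) = int (b6_plus (T \<restriction> K)) - int (b6_plus (T' \<restriction> K))"
    if "K \<subseteq> V" for K
    using b6_plus_induce[OF T.digraph_axioms] b6_plus_induce[OF T'.digraph_axioms] assms(3,4) that
      sum_of_bool_diff_eq[where K = K and t = 6 and P = P and Q = Q] finite_subset[OF that finV]
    unfolding f_def P_def Q_def E_def F_def by simp
  have card_V: "6 + k \<le> card V" using assms(5,10) by simp
  show ?thesis
  proof (intro conjI impI)
    assume eq: "\<forall>K. K \<subseteq> V \<and> card K = k \<longrightarrow> b6_plus (T \<restriction> K) = b6_plus (T' \<restriction> K)"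
    \<comment> \<open>Modulus 0 turns divisibility into equality with 0; the binomials can be
      cancelled because they are positive.\<close>
    have "0 dvd f S" if "S \<subseteq> V" "card S = 6" for S
    proof (rule inclusion_kernel_trivial[of V 6 k 0 f])
      show "0 dvd (\<Sum>S | S \<subseteq> K \<and> card S = 6. f S)" if "K \<subseteq> V" "card K = k" for K
        using sum_f[OF that(1)] eq that by simp
      show "0 dvd a" if "1 \<le> i" "i \<le> 6" "0 dvd a * int (k - i choose (6 - i))" for i a
      proof -
        have "6 - i \<le> k - i" using assms(9) by (rule diff_le_mono)
        then show ?thesis using that(3) by simp
      qed
      show "0 dvd a" if "0 dvd a * int (k choose 6)" for a
        using that assms(9) by simp
    qed (use finV card_V assms(9) that in auto)
    then show "hereditarily_isomorphic T' T"
      by (intro hereditary) simp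
  next
    assume cong: "\<forall>K. K \<subseteq> V \<and> card K = k \<longrightarrow> [b6_plus (T \<restriction> K) = b6_plus (T' \<restriction> K)] (mod p)"
    have main: "hereditarily_isomorphic T' T"
      if "(p \<ge> 7 \<and> (d 0 \<ge> 6 \<or> d 0 = 0)) \<or> (p = 5 \<and> d 0 = 1 \<and> d 1 \<noteq> 0) \<or>
        (p = 3 \<and> d 0 = 0 \<and> d 1 = 2) \<or> (p = 3 \<and> d 0 = 0 \<and> d 1 = 0) \<or>
        (p = 2 \<and> d 0 = 0 \<and> d 1 = 1 \<and> d 2 = 1)"
    proof (rule hereditary)
      fix S assume S: "S \<subseteq> V" "card S = 6"
      have p2: "2 \<le> p" using assms(7) prime_ge_2_nat by blast
      note not_dvd = digit_conditions_not_dvd[OF assms(7,8,9) that]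
      have dvd_cancel: "int p dvd a" if "int p dvd a * int n" "\<not> p dvd n" for a n
        using that assms(7) by (simp add: prime_dvd_mult_iff)
      have sums: "int p dvd (\<Sum>S | S \<subseteq> K \<and> card S = 6. f S)" if "K \<subseteq> V" "card K = k" for K
        using sum_f[OF that(1)] cong that by (simp add: cong_iff_dvd_diff cong_int_iff[symmetric])
      have cancel: "int p dvd a"
        if "1 \<le> i" "i \<le> 6" "int p dvd a * int (k - i choose (6 - i))" for i a
        using dvd_cancel[OF that(3)] not_dvd that(1,2) by simp
      note kernel = finV assms(9) card_V sums cancel
      have f_range: "f S \<in> {-1, 0, 1}" for S
        unfolding f_def by (auto simp: of_bool_def)
      have small: "x = 0" if "int p dvd x" "\<bar>x\<bar> < int p" for x
        using dvd_imp_le_int[OF _ that(1)] that(2) by linarith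
      show "f S = 0"
      \<comment> \<open>If \<open>p\<close> does not divide this binomial, \<open>f\<close> vanishes
        modulo \<open>p\<close>, hence exactly. Otherwise \<open>f\<close> is only known to be
        constant, and its value has to be pinned down.\<close>
      proof (cases "p dvd (k choose 6)")
        case False
        have "int p dvd f S"
          by (rule inclusion_kernel_trivial[where V = V and t = 6 and k = k and f = f, OF kernel
                dvd_cancel[OF _ False] S])
        then show ?thesis
          using small[of "f S"] f_range[of S] p2 by auto
      next
        case True
        then have p3: "3 \<le> p" using not_dvd by blast
        \<comment> \<open>Values in -1, 0, 1 differ by at most 2, so congruence modulo
          \<open>p \<ge> 3\<close> is equality.\<close>
        have const: "f R = f S" if "R \<subseteq> V" "card R = 6" for R
        proof -
          have "int p dvd f R - f S"
            by (rule inclusion_kernel_constant[where V = V and t = 6 and k = k and f = f, OF kernel that S])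
          then show ?thesis
            using small[of "f R - f S"] f_range[of R] f_range[of S] p3 by auto
        qed
        have "12 \<le> card V" using card_V assms(9) by simp
        then obtain R R' where R: "R \<subseteq> V" "card R = 6" "\<not> P R" and R': "R' \<subseteq> V" "card R' = 6" "\<not> Q R'"
          using not_all_six_subsets_beta6[OF finV tour_E] not_all_six_subsets_beta6[OF finV tour_F]
          unfolding P_def Q_def by blast
        \<comment> \<open>A 6-set that is not a copy in \<open>T\<close> bounds the constant value
          above by 0; one that is not a copy in \<open>T'\<close> bounds it below.\<close>
        have "f S \<le> 0" using const[OF R(1,2)] R(3) unfolding f_def[of R] by (simp add: of_bool_def split: if_splits)
        moreover have "0 \<le> f S"
          using const[OF R'(1,2)] R'(3) unfolding f_def[of R'] by (simp add: of_bool_def split: if_splits)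
        ultimately show ?thesis by simp
      qed
    qed
    show "hereditarily_isomorphic T' T" if "p \<ge> 7 \<and> (d 0 \<ge> 6 \<or> d 0 = 0)"
      using that main by blast
    show "hereditarily_isomorphic T' T" if "(p = 5 \<and> d 0 = 1 \<and> d 1 \<noteq> 0) \<or>
           (p = 3 \<and> d 0 = 0 \<and> d 1 = 2) \<or>
           (p = 3 \<and> d 0 = 0 \<and> d 1 = 0) \<or>
           (p = 2 \<and> d 0 = 0 \<and> d 1 = 1 \<and> d 2 = 1)"
      using that main by blast
  qed
qed

end
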